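(* The spaces $\mathrm{(cid)}\cap\mathrm{(qtame)}$ and $\mathrm{(cfid)}\cap\mathrm{(qtame)}$, with the topology induced by the interleaving distance, are Baire spaces.
   Context: Fix a field $\mathbf{k}$. A persistence module is a functor $M:(\mathbb{R},\le)\to \mathrm{Vect}_{\mathbf{k}}$; "persistence module" means isomorphism class. For an interval $J\subset\mathbb{R}$, the interval module $J$ is $\mathbf{k}$ at points of $J$ and $0$ elsewhere, with identity maps between points of $J$ and zero maps otherwise. For $\varepsilon\ge 0$, $M,N$ are $\varepsilon$-interleaved if there are families of linear maps $\varphi_a:M(a)\to N(a+\varepsilon)$ and $\psi_a:N(a)\to M(a+\varepsilon)$, natural in $a\in\mathbb{R}$, with $\psi_{a+\varepsilon}\varphi_a=M(a\le a+2\varepsilon)$ and $\varphi_{a+\varepsilon}\psi_a=N(a\le a+2\varepsilon)$ for all $a$. The interleaving distance is $d_I(M,N)=\inf\{\varepsilon\ge0 : M,N \text{ are } \varepsilon\text{-interleaved}\}$ ($\infty$ if there is none). It is an extended pseudometric; the induced topology has the open balls $B_r(M)=\{N: d_I(M,N)<r\}$, $r>0$, as a base. $\mathrm{(qtame)}$: persistence modules $M$ with $M(a<b)$ of finite rank for all $a<b$; $\mathrm{(cid)}$: direct sums of countably many interval modules; $\mathrm{(cfid)}$: those in $\mathrm{(cid)}$ with all intervals finite (bounded). A topological space $X$ is a Baire space if for any countable collection of closed sets in $X$ each with empty interior (containing no nonempty open set of $X$), their union also has empty interior in $X$. *)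

theory Defs
  imports "HOL-Analysis.Analysis" "HOL-Library.Function_Algebras"
begin

text \<open>
  The vector spaces \<open>M(a)\<close> of a persistence module are the subspaces \<open>fib M a\<close> of one ambient
  vector space (the type \<open>'v\<close> with scalar multiplication \<open>smul M\<close>), and \<open>tr M a b\<close> is the map
  \<open>M(a \<le> b)\<close>.  The values of \<open>tr M a b\<close> for \<open>\<not> a \<le> b\<close> or outside \<open>fib M a\<close> carry no meaning.
\<close>

record ('k, 'v) pmod =
  smul :: "'k \<Rightarrow> 'v \<Rightarrow> 'v"
  fib :: "real \<Rightarrow> 'v set"
  tr :: "real \<Rightarrow> real \<Rightarrow> 'v \<Rightarrow> 'v"

definition linear_between ::
    "('k \<Rightarrow> 'v \<Rightarrow> 'v) \<Rightarrow> ('k \<Rightarrow> 'w \<Rightarrow> 'w) \<Rightarrow> 'v::plus set \<Rightarrow> 'w::plus set \<Rightarrow> ('v \<Rightarrow> 'w) \<Rightarrow> bool" where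
  "linear_between s1 s2 V W f \<longleftrightarrow>
     f ` V \<subseteq> W \<and>
     (\<forall>x\<in>V. \<forall>y\<in>V. f (x + y) = f x + f y) \<and>
     (\<forall>c. \<forall>x\<in>V. f (s1 c x) = s2 c (f x))"

definition persistence_module :: "('k::field, 'v::ab_group_add) pmod \<Rightarrow> bool" where
  "persistence_module M \<longleftrightarrow>
     vector_space (smul M) \<and>
     (\<forall>a. module.subspace (smul M) (fib M a)) \<and>
     (\<forall>a b. a \<le> b \<longrightarrow> linear_between (smul M) (smul M) (fib M a) (fib M b) (tr M a b)) \<and>
     (\<forall>a. \<forall>x\<in>fib M a. tr M a a x = x) \<and>
     (\<forall>a b c. a \<le> b \<longrightarrow> b \<le> c \<longrightarrow> (\<forall>x\<in>fib M a. tr M b c (tr M a b x) = tr M a c x))"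

definition shift_hom ::
    "real \<Rightarrow> ('k, 'v::plus) pmod \<Rightarrow> ('k, 'w::plus) pmod \<Rightarrow> (real \<Rightarrow> 'v \<Rightarrow> 'w) \<Rightarrow> bool" where
  "shift_hom \<epsilon> M N \<phi> \<longleftrightarrow>
     (\<forall>a. linear_between (smul M) (smul N) (fib M a) (fib N (a + \<epsilon>)) (\<phi> a)) \<and>
     (\<forall>a b. a \<le> b \<longrightarrow> (\<forall>x\<in>fib M a. \<phi> b (tr M a b x) = tr N (a + \<epsilon>) (b + \<epsilon>) (\<phi> a x)))"

definition pm_isomorphic :: "('k, 'v::plus) pmod \<Rightarrow> ('k, 'w::plus) pmod \<Rightarrow> bool" where
  "pm_isomorphic M N \<longleftrightarrow>
     (\<exists>\<phi> \<psi>. shift_hom 0 M N \<phi> \<and> shift_hom 0 N M \<psi> \<and>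
        (\<forall>a. \<forall>x\<in>fib M a. \<psi> a (\<phi> a x) = x) \<and>
        (\<forall>a. \<forall>y\<in>fib N a. \<phi> a (\<psi> a y) = y))"

definition interleaved :: "real \<Rightarrow> ('k, 'v::plus) pmod \<Rightarrow> ('k, 'w::plus) pmod \<Rightarrow> bool" where
  "interleaved \<epsilon> M N \<longleftrightarrow>
     (\<exists>\<phi> \<psi>. shift_hom \<epsilon> M N \<phi> \<and> shift_hom \<epsilon> N M \<psi> \<and>
        (\<forall>a. \<forall>x\<in>fib M a. \<psi> (a + \<epsilon>) (\<phi> a x) = tr M a (a + 2 * \<epsilon>) x) \<and>
        (\<forall>a. \<forall>y\<in>fib N a. \<phi> (a + \<epsilon>) (\<psi> a y) = tr N a (a + 2 * \<epsilon>) y))"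

definition interleaving_dist :: "('k, 'v::plus) pmod \<Rightarrow> ('k, 'w::plus) pmod \<Rightarrow> ereal" where
  "interleaving_dist M N = Inf {ereal \<epsilon> |\<epsilon>. 0 \<le> \<epsilon> \<and> interleaved \<epsilon> M N}"

definition interval_module :: "real set \<Rightarrow> ('k::field, 'k) pmod" where
  "interval_module J =
     \<lparr>smul = (*),
      fib = (\<lambda>a. if a \<in> J then UNIV else {0}),
      tr = (\<lambda>a b x. if a \<in> J \<and> b \<in> J then x else 0)\<rparr>"

text \<open>
  External direct sum over the index set \<open>I\<close>, realised as finitely supported functions vanishing
  off \<open>I\<close>.  The scalar multiplication lives on the whole type \<open>'i \<Rightarrow> 'v\<close>, so for the result to be a
  persistence module \<open>smul (F i)\<close> has to be a vector space structure for \<open>i \<notin> I\<close>, too; this is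
  the case for every family of interval modules.
\<close>

definition direct_sum :: "'i set \<Rightarrow> ('i \<Rightarrow> ('k, 'v::zero) pmod) \<Rightarrow> ('k, 'i \<Rightarrow> 'v) pmod" where
  "direct_sum I F =
     \<lparr>smul = (\<lambda>c f i. smul (F i) c (f i)),
      fib = (\<lambda>a. {f. finite {i. f i \<noteq> 0} \<and> (\<forall>i\<in>I. f i \<in> fib (F i) a) \<and> (\<forall>i. i \<notin> I \<longrightarrow> f i = 0)}),
      tr = (\<lambda>a b f i. if i \<in> I then tr (F i) a b (f i) else 0)\<rparr>"

definition qtame :: "('k::field, 'v::ab_group_add) pmod \<Rightarrow> bool" where
  "qtame M \<longleftrightarrow> (\<forall>a b. a < b \<longrightarrow>
     (\<exists>B. finite B \<and> tr M a b ` fib M a = module.span (smul M) B))"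

text \<open>Countable families, finite and empty ones included, are indexed by sets of natural numbers.\<close>

definition cid :: "('k::field, 'v::ab_group_add) pmod \<Rightarrow> bool" where
  "cid M \<longleftrightarrow> (\<exists>(I :: nat set) J.
     (\<forall>i\<in>I. is_interval (J i) \<and> J i \<noteq> {}) \<and>
     pm_isomorphic M (direct_sum I (\<lambda>i. interval_module (J i))))"

definition cfid :: "('k::field, 'v::ab_group_add) pmod \<Rightarrow> bool" where
  "cfid M \<longleftrightarrow> (\<exists>(I :: nat set) J.
     (\<forall>i\<in>I. is_interval (J i) \<and> J i \<noteq> {} \<and> bounded (J i)) \<and>
     pm_isomorphic M (direct_sum I (\<lambda>i. interval_module (J i))))"

text \<open>
  Isomorphism classes are taken within the persistence modules whose elements lie in
  \<open>nat \<Rightarrow> 'k\<close>.  The direct sums in \<^const>\<open>cid\<close> are themselves such modules, so every isomorphism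
  class of countable direct sums of interval modules is represented.
\<close>

type_synonym 'k upmod = "('k, nat \<Rightarrow> 'k) pmod"

definition pm_iso_rel :: "('k::field upmod \<times> 'k upmod) set" where
  "pm_iso_rel = {(M, N). persistence_module M \<and> persistence_module N \<and> pm_isomorphic M N}"

definition iso_classes :: "('k::field upmod \<Rightarrow> bool) \<Rightarrow> 'k upmod set set" where
  "iso_classes P = {M. persistence_module M \<and> P M} // pm_iso_rel"

text \<open>The interleaving distance does not depend on the representatives.\<close>

definition class_dist :: "'k::field upmod set \<Rightarrow> 'k upmod set \<Rightarrow> ereal" where
  "class_dist X Y = (INF M\<in>X. INF N\<in>Y. interleaving_dist M N)"

definition class_ball :: "'k::field upmod set set \<Rightarrow> 'k upmod set \<Rightarrow> real \<Rightarrow> 'k upmod set set" where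
  "class_ball S X r = {Y \<in> S. class_dist X Y < ereal r}"

definition interleaving_topology :: "'k::field upmod set set \<Rightarrow> 'k upmod set topology" where
  "interleaving_topology S =
     topology (\<lambda>U. U \<subseteq> S \<and> (\<forall>X\<in>U. \<exists>r>0. class_ball S X r \<subseteq> U))"

lemma istopology_interleaving:
  "istopology (\<lambda>U. U \<subseteq> S \<and> (\<forall>X\<in>U. \<exists>r>0. class_ball S X r \<subseteq> U))"
  unfolding istopology_def
proof (intro conjI allI impI)
  fix U V
  assume U: "U \<subseteq> S \<and> (\<forall>X\<in>U. \<exists>r>0. class_ball S X r \<subseteq> U)"
    and V: "V \<subseteq> S \<and> (\<forall>X\<in>V. \<exists>r>0. class_ball S X r \<subseteq> V)"
  show "U \<inter> V \<subseteq> S" using U by blast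
  show "\<forall>X\<in>U \<inter> V. \<exists>r>0. class_ball S X r \<subseteq> U \<inter> V"
  proof
    fix X assume X: "X \<in> U \<inter> V"
    with U obtain r where r: "r > 0" "class_ball S X r \<subseteq> U" by blast
    from X V obtain s where s: "s > 0" "class_ball S X s \<subseteq> V" by blast
    have "class_ball S X (min r s) \<subseteq> class_ball S X r \<inter> class_ball S X s"
      by (auto simp: class_ball_def elim!: less_le_trans)
    then have "class_ball S X (min r s) \<subseteq> U \<inter> V"
      using r s by blast
    then show "\<exists>r>0. class_ball S X r \<subseteq> U \<inter> V"
      using r s by (intro exI[of _ "min r s"]) auto
  qed
qed (fast | meson Union_upper order_trans UnionE)+

lemma openin_interleaving_topology:
  "openin (interleaving_topology S) U \<longleftrightarrow>
     U \<subseteq> S \<and> (\<forall>X\<in>U. \<exists>r>0. class_ball S X r \<subseteq> U)"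
  unfolding interleaving_topology_def
  by (simp only: topology_inverse'[OF istopology_interleaving])

definition baire_space :: "'a topology \<Rightarrow> bool" where
  "baire_space X \<longleftrightarrow>
     (\<forall>F. countable F \<longrightarrow> (\<forall>C\<in>F. closedin X C \<and> X interior_of C = {}) \<longrightarrow>
        X interior_of (\<Union>F) = {})"

end

theory Submission
  imports Defs
begin

text \<open>
  As for complete metric spaces, the Baire property comes from a nested sequence of balls with
  centres outside the given closed sets; the point is to find a limit of the centres.  Every
  class is that of a barcode \<open>J :: nat \<Rightarrow> real set\<close>, a sequence of possibly empty intervals, with
  module \<open>bars J\<close>.  Two intervals are \<open>\<epsilon>\<close>-close if each contains the points whose
  \<open>\<epsilon>\<close>-translates in both directions lie in the other (\<open>erosion_close\<close>).  Barcodes that are close bar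
  by bar, with the same indices, have interleaved modules (\<open>interleaved_bars\<close>), and the bar-by-bar
  limit of a sequence of barcodes with summable distances is again a barcode close to the members of
  the sequence (\<open>erosion_close_limit_bar\<close>).  So it suffices to choose the points of the usual nested
  sequence such that consecutive barcodes are close bar by bar.

  What has to be shown is thus a converse: a module near a given one has a barcode that can be
  indexed so as to be close bar by bar.  In general this is the algebraic stability theorem.
  In a Baire argument, however, the given module may be taken from a dense set, and the barcodes
  with endpoints on a grid \<open>h\<int>\<close> are dense.  For such a barcode \<open>J\<close>, the rank of \<open>bars J\<close> between two
  points depends only on the grid cells that contain them.  The rank of an interleaved module is
  squeezed between two ranks of \<open>bars J\<close> (\<open>rank_le_of_interleaved\<close>), so if the
  interleaving parameter is less than \<open>h / 4\<close>, then for every finite set of cells both barcodes have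
  equally many bars containing the middle parts of these cells (\<open>cells_card_eq\<close>).  By
  inclusion-exclusion and a finiteness argument they have equally many bars with any prescribed
  nonempty set of cells (\<open>fibre_card_eq\<close>).  A bijection between these bars, together with an arbitrary
  placement of the remaining short bars at free indices, is accurate up to \<open>h\<close> (\<open>match_to_grid\<close>).

  The error is \<open>h\<close> however small the interleaving parameter is.  This is harmless: the mesh
  \<open>h\<close> is chosen after the open set which the limit must not leave, and the meshes are at least halved
  in each step.
\<close>

section \<open>Morphisms of persistence modules\<close>

lemma shift_hom_in: "shift_hom e M N \<phi> \<Longrightarrow> x \<in> fib M a \<Longrightarrow> \<phi> a x \<in> fib N (a + e)"
  unfolding shift_hom_def linear_between_def by blast

lemma shift_hom_natural:
  "shift_hom e M N \<phi> \<Longrightarrow> a \<le> b \<Longrightarrow> x \<in> fib M a \<Longrightarrow>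
    \<phi> b (tr M a b x) = tr N (a + e) (b + e) (\<phi> a x)"
  unfolding shift_hom_def by blast

lemma shift_hom_comp:
  assumes "shift_hom e M N \<phi>" "shift_hom e' N P \<psi>"
  shows "shift_hom (e + e') M P (\<lambda>a x. \<psi> (a + e) (\<phi> a x))"
  using assms unfolding shift_hom_def linear_between_def
  by (simp add: image_subset_iff add.assoc[symmetric])

lemma tr_in: "persistence_module M \<Longrightarrow> a \<le> b \<Longrightarrow> x \<in> fib M a \<Longrightarrow> tr M a b x \<in> fib M b"
  unfolding persistence_module_def linear_between_def by blast

lemma tr_id: "persistence_module M \<Longrightarrow> x \<in> fib M a \<Longrightarrow> tr M a a x = x"
  unfolding persistence_module_def by blast

lemma tr_tr:
  "persistence_module M \<Longrightarrow> a \<le> b \<Longrightarrow> b \<le> c \<Longrightarrow> x \<in> fib M a \<Longrightarrow>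
    tr M b c (tr M a b x) = tr M a c x"
  unfolding persistence_module_def by blast

lemma interleaved_sym: "interleaved e M N \<Longrightarrow> interleaved e N M"
  unfolding interleaved_def by blast

lemma interleaved_trans:
  assumes M: "persistence_module M" and P: "persistence_module P"
    and e: "0 \<le> e" and e': "0 \<le> e'"
    and MN: "interleaved e M N" and NP: "interleaved e' N P"
  shows "interleaved (e + e') M P"
proof -
  obtain \<phi> \<psi> where f: "shift_hom e M N \<phi>" "shift_hom e N M \<psi>"
     "\<And>a x. x \<in> fib M a \<Longrightarrow> \<psi> (a + e) (\<phi> a x) = tr M a (a + 2 * e) x"
     "\<And>a x. x \<in> fib N a \<Longrightarrow> \<phi> (a + e) (\<psi> a x) = tr N a (a + 2 * e) x"
    using MN unfolding interleaved_def by blast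
  obtain \<alpha> \<beta> where g: "shift_hom e' N P \<alpha>" "shift_hom e' P N \<beta>"
     "\<And>a x. x \<in> fib N a \<Longrightarrow> \<beta> (a + e') (\<alpha> a x) = tr N a (a + 2 * e') x"
     "\<And>a x. x \<in> fib P a \<Longrightarrow> \<alpha> (a + e') (\<beta> a x) = tr P a (a + 2 * e') x"
    using NP unfolding interleaved_def by blast
  have hom1: "shift_hom (e + e') M P (\<lambda>a x. \<alpha> (a + e) (\<phi> a x))"
    by (rule shift_hom_comp[OF f(1) g(1)])
  have hom2: "shift_hom (e + e') P M (\<lambda>a x. \<psi> (a + e') (\<beta> a x))"
    using shift_hom_comp[OF g(2) f(2)] by (simp add: add.commute)
  have c1: "\<psi> (a + (e + e') + e') (\<beta> (a + (e + e')) (\<alpha> (a + e) (\<phi> a x))) = tr M a (a + 2 * (e + e')) x"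
    if x: "x \<in> fib M a" for a x
  proof -
    have y: "\<phi> a x \<in> fib N (a + e)" using f(1) x by (rule shift_hom_in)
    have "\<beta> (a + (e + e')) (\<alpha> (a + e) (\<phi> a x)) = tr N (a + e) (a + e + 2 * e') (\<phi> a x)"
      using g(3)[OF y] by (simp add: add.assoc)
    then have "\<psi> (a + (e + e') + e') (\<beta> (a + (e + e')) (\<alpha> (a + e) (\<phi> a x)))
        = \<psi> (a + e + 2 * e') (tr N (a + e) (a + e + 2 * e') (\<phi> a x))"
      by (simp add: algebra_simps)
    also have "\<dots> = tr M (a + e + e) (a + e + 2 * e' + e) (\<psi> (a + e) (\<phi> a x))"
      using e' y by (intro shift_hom_natural[OF f(2)]) auto
    also have "\<dots> = tr M (a + 2 * e) (a + 2 * (e + e')) (tr M a (a + 2 * e) x)"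
      using f(3)[OF x] by (simp add: algebra_simps)
    also have "\<dots> = tr M a (a + 2 * (e + e')) x"
      using e e' by (intro tr_tr[OF M _ _ x]) auto
    finally show ?thesis .
  qed
  have c2: "\<alpha> (a + (e + e') + e) (\<phi> (a + (e + e')) (\<psi> (a + e') (\<beta> a x))) = tr P a (a + 2 * (e + e')) x"
    if x: "x \<in> fib P a" for a x
  proof -
    have y: "\<beta> a x \<in> fib N (a + e')" using g(2) x by (rule shift_hom_in)
    have "\<phi> (a + (e + e')) (\<psi> (a + e') (\<beta> a x)) = tr N (a + e') (a + e' + 2 * e) (\<beta> a x)"
      using f(4)[OF y] by (simp add: algebra_simps)
    then have "\<alpha> (a + (e + e') + e) (\<phi> (a + (e + e')) (\<psi> (a + e') (\<beta> a x)))
        = \<alpha> (a + e' + 2 * e) (tr N (a + e') (a + e' + 2 * e) (\<beta> a x))"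
      by (simp add: algebra_simps)
    also have "\<dots> = tr P (a + e' + e') (a + e' + 2 * e + e') (\<alpha> (a + e') (\<beta> a x))"
      using e y by (intro shift_hom_natural[OF g(1)]) auto
    also have "\<dots> = tr P (a + 2 * e') (a + 2 * (e + e')) (tr P a (a + 2 * e') x)"
      using g(4)[OF x] by (simp add: algebra_simps)
    also have "\<dots> = tr P a (a + 2 * (e + e')) x"
      using e e' by (intro tr_tr[OF P _ _ x]) auto
    finally show ?thesis .
  qed
  show ?thesis
    unfolding interleaved_def
    using hom1 hom2 c1 c2 by blast
qed

text \<open>
  Isomorphism invariance thereby becomes a case of the triangle inequality.
\<close>

lemma pm_isomorphic_iff_interleaved:
  assumes "persistence_module M" "persistence_module N"
  shows "pm_isomorphic M N \<longleftrightarrow> interleaved 0 M N"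
  unfolding pm_isomorphic_def interleaved_def
  using tr_id[OF assms(1)] tr_id[OF assms(2)] by simp

lemma interleaved_refl: "persistence_module M \<Longrightarrow> interleaved 0 M M"
  unfolding interleaved_def
  by (intro exI[of _ "\<lambda>a x. x"])
     (auto simp: shift_hom_def linear_between_def tr_id)

lemma equiv_pm_iso_rel:
  "equiv {M :: 'k::field upmod. persistence_module M} pm_iso_rel"
proof (rule equivI)
  show "pm_iso_rel \<subseteq> {M :: 'k upmod. persistence_module M} \<times> {M :: 'k upmod. persistence_module M}"
    unfolding pm_iso_rel_def by blast
  show "refl_on {M :: 'k upmod. persistence_module M} pm_iso_rel"
    unfolding refl_on_def pm_iso_rel_def
    by (auto simp: pm_isomorphic_iff_interleaved interleaved_refl)
  show "sym (pm_iso_rel :: ('k upmod \<times> 'k upmod) set)"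
    unfolding sym_def pm_iso_rel_def
    by (auto simp: pm_isomorphic_iff_interleaved interleaved_sym)
  show "trans (pm_iso_rel :: ('k upmod \<times> 'k upmod) set)"
  proof (rule transI)
    fix M N P :: "'k upmod"
    assume "(M, N) \<in> pm_iso_rel" "(N, P) \<in> pm_iso_rel"
    then show "(M, P) \<in> pm_iso_rel"
      unfolding pm_iso_rel_def
      using interleaved_trans[of M P 0 0 N] by (auto simp: pm_isomorphic_iff_interleaved)
  qed
qed

abbreviation iso_class :: "'k::field upmod \<Rightarrow> 'k upmod set" where
  "iso_class M \<equiv> pm_iso_rel `` {M}"

lemma mem_iso_class:
  "persistence_module M \<Longrightarrow>
    N \<in> iso_class M \<longleftrightarrow> persistence_module N \<and> interleaved 0 M N"
  unfolding pm_iso_rel_def by (auto simp: pm_isomorphic_iff_interleaved)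

text \<open>
  Changing the representatives means composing with \<open>0\<close>-interleavings, so any pair of
  representatives computes the distance of the classes.
\<close>

lemma class_dist_less_iff:
  assumes M: "persistence_module M" and N: "persistence_module N"
  shows "class_dist (iso_class M) (iso_class N) < ereal r \<longleftrightarrow>
    (\<exists>e. 0 \<le> e \<and> e < r \<and> interleaved e M N)"
proof
  assume "class_dist (iso_class M) (iso_class N) < ereal r"
  then obtain M' N' where M': "M' \<in> iso_class M" and N': "N' \<in> iso_class N"
    and d: "interleaving_dist M' N' < ereal r"
    unfolding class_dist_def INF_less_iff by blast
  from d obtain e where e: "0 \<le> e" "e < r" "interleaved e M' N'"
    unfolding interleaving_dist_def Inf_less_iff by auto
  have M'2: "persistence_module M'" "interleaved 0 M M'"
    using M' mem_iso_class[OF M] by auto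
  have N'2: "persistence_module N'" "interleaved 0 N' N"
    using N' mem_iso_class[OF N] by (auto intro: interleaved_sym)
  have "interleaved (0 + e) M N'"
    using interleaved_trans[OF M N'2(1) _ e(1) M'2(2) e(3)] by simp
  then have "interleaved e M N"
    using interleaved_trans[OF M N e(1) _ _ N'2(2)] by simp
  with e show "\<exists>e. 0 \<le> e \<and> e < r \<and> interleaved e M N" by blast
next
  assume "\<exists>e. 0 \<le> e \<and> e < r \<and> interleaved e M N"
  then obtain e where e: "0 \<le> e" "e < r" "interleaved e M N" by blast
  have "class_dist (iso_class M) (iso_class N) \<le> interleaving_dist M N"
    unfolding class_dist_def
    using M N by (intro INF_lower2[of M] INF_lower2[of N])
      (simp_all only: mem_iso_class interleaved_refl order.refl simp_thms)
  also have "\<dots> \<le> ereal e"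
    unfolding interleaving_dist_def using e by (intro Inf_lower) blast
  also have "\<dots> < ereal r" using e by simp
  finally show "class_dist (iso_class M) (iso_class N) < ereal r" .
qed

lemma iso_classes_cases:
  assumes "X \<in> iso_classes P"
  obtains M where "persistence_module M" "P M" "X = iso_class M"
  using assms unfolding iso_classes_def quotient_def by blast

lemma openin_class_ball:
  assumes S: "S = iso_classes P" and X: "X \<in> S"
  shows "openin (interleaving_topology S) (class_ball S X r)"
  unfolding openin_interleaving_topology
proof (intro conjI ballI)
  show "class_ball S X r \<subseteq> S" unfolding class_ball_def by blast
  fix Y assume Y: "Y \<in> class_ball S X r"
  obtain M where M: "persistence_module M" "X = iso_class M"
    using X unfolding S by (rule iso_classes_cases)
  obtain N where N: "persistence_module N" "Y = iso_class N"
    using Y unfolding S class_ball_def by (blast elim: iso_classes_cases)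
  obtain e where e: "0 \<le> e" "e < r" "interleaved e M N"
    using Y unfolding class_ball_def M(2) N(2)
    by (auto simp: class_dist_less_iff[OF M(1) N(1)])
  have "class_ball S Y (r - e) \<subseteq> class_ball S X r"
  proof
    fix Z assume Z: "Z \<in> class_ball S Y (r - e)"
    obtain L where L: "persistence_module L" "Z = iso_class L"
      using Z unfolding S class_ball_def by (blast elim: iso_classes_cases)
    obtain e' where e': "0 \<le> e'" "e' < r - e" "interleaved e' N L"
      using Z unfolding class_ball_def L(2) N(2)
      by (auto simp: class_dist_less_iff[OF N(1) L(1)])
    have "interleaved (e + e') M L"
      by (rule interleaved_trans[OF M(1) L(1) e(1) e'(1) e(3) e'(3)])
    then have "class_dist X Z < ereal r"
      unfolding M(2) L(2) class_dist_less_iff[OF M(1) L(1)]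
      using e e' by (intro exI[of _ "e + e'"]) simp
    then show "Z \<in> class_ball S X r"
      using Z unfolding class_ball_def by simp
  qed
  then show "\<exists>s>0. class_ball S Y s \<subseteq> class_ball S X r"
    using e by (intro exI[of _ "r - e"]) simp
qed

section \<open>Barcode modules\<close>

text \<open>
  Every natural number is an index: an empty interval contributes the zero module.  This makes it
  possible to insert new bars at free indices and to let bars vanish without changing the index set.
\<close>

definition bars :: "(nat \<Rightarrow> real set) \<Rightarrow> 'k::field upmod" where
  "bars J = direct_sum UNIV (\<lambda>i. interval_module (J i))"

lemma smul_bars: "smul (bars J) = (\<lambda>c f i. c * f i)"
  by (simp add: bars_def direct_sum_def interval_module_def)

lemma fib_bars: "fib (bars J) a = {f. finite {i. f i \<noteq> 0} \<and> (\<forall>i. f i \<noteq> 0 \<longrightarrow> a \<in> J i)}"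
  by (auto simp: bars_def direct_sum_def interval_module_def)

lemma tr_bars: "tr (bars J) a b f = (\<lambda>i. if a \<in> J i \<and> b \<in> J i then f i else 0)"
  by (simp add: bars_def direct_sum_def interval_module_def)

lemma direct_sum_interval_eq_bars:
  "direct_sum I (\<lambda>i. interval_module (J i)) = bars (\<lambda>i. if i \<in> I then J i else {})"
  by (auto simp: bars_def direct_sum_def interval_module_def fun_eq_iff)

lemma vector_space_coordinatewise:
  "vector_space (\<lambda>(c :: 'k::field) (f :: nat \<Rightarrow> 'k) i. c * f i)"
  by unfold_locales (auto simp: fun_eq_iff algebra_simps)

lemma is_interval_between:
  fixes J :: "real set"
  shows "is_interval J \<Longrightarrow> a \<in> J \<Longrightarrow> b \<in> J \<Longrightarrow> a \<le> x \<Longrightarrow> x \<le> b \<Longrightarrow> x \<in> J"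
  unfolding is_interval_1 by blast

lemma finite_support_if:
  "finite {i. f i \<noteq> (0::'a::zero)} \<Longrightarrow> finite {i. (if P i then f i else 0) \<noteq> 0}"
  by (erule rev_finite_subset) auto

lemma finite_support_add:
  fixes f g :: "nat \<Rightarrow> 'a::field"
  assumes "finite {i. f i \<noteq> 0}" "finite {i. g i \<noteq> 0}"
  shows "finite {i. f i + g i \<noteq> 0}"
proof (rule finite_subset)
  show "{i. f i + g i \<noteq> 0} \<subseteq> {i. f i \<noteq> 0} \<union> {i. g i \<noteq> 0}" by auto
qed (use assms in simp)

lemma persistence_module_bars:
  assumes J: "\<And>i. is_interval (J i)"
  shows "persistence_module (bars J :: 'k::field upmod)"
proof -
  interpret V: vector_space "\<lambda>(c :: 'k) (f :: nat \<Rightarrow> 'k) i. c * f i"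
    by (rule vector_space_coordinatewise)
  show ?thesis
    unfolding persistence_module_def
  proof (intro conjI allI impI ballI)
    show "vector_space (smul (bars J :: 'k upmod))"
      unfolding smul_bars by (rule vector_space_coordinatewise)
    fix a b c :: real and f :: "nat \<Rightarrow> 'k"
    show "module.subspace (smul (bars J)) (fib (bars J :: 'k upmod) a)"
      unfolding smul_bars fib_bars
    proof (rule V.subspaceI)
      show "0 \<in> {f :: nat \<Rightarrow> 'k. finite {i. f i \<noteq> 0} \<and> (\<forall>i. f i \<noteq> 0 \<longrightarrow> a \<in> J i)}" by simp
    next
      fix f g :: "nat \<Rightarrow> 'k" and c
      assume "f \<in> {f. finite {i. f i \<noteq> 0} \<and> (\<forall>i. f i \<noteq> 0 \<longrightarrow> a \<in> J i)}"
        "g \<in> {f. finite {i. f i \<noteq> 0} \<and> (\<forall>i. f i \<noteq> 0 \<longrightarrow> a \<in> J i)}"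
      then show "f + g \<in> {f. finite {i. f i \<noteq> 0} \<and> (\<forall>i. f i \<noteq> 0 \<longrightarrow> a \<in> J i)}"
        by (auto intro!: finite_support_add) (metis add_0)
    next
      fix f :: "nat \<Rightarrow> 'k" and c
      assume "f \<in> {f. finite {i. f i \<noteq> 0} \<and> (\<forall>i. f i \<noteq> 0 \<longrightarrow> a \<in> J i)}"
      then show "(\<lambda>i. c * f i) \<in> {f. finite {i. f i \<noteq> 0} \<and> (\<forall>i. f i \<noteq> 0 \<longrightarrow> a \<in> J i)}"
        by (auto elim: rev_finite_subset)
    qed
    show "linear_between (smul (bars J)) (smul (bars J)) (fib (bars J :: 'k upmod) a) (fib (bars J :: 'k upmod) b)
        (tr (bars J) a b)"
      unfolding linear_between_def smul_bars fib_bars tr_bars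
      by (auto simp: fun_eq_iff finite_support_if split: if_splits)
    assume f: "f \<in> fib (bars J) a"
    show "tr (bars J) a a f = f"
      using f unfolding fib_bars tr_bars by (auto simp: fun_eq_iff)
    assume "a \<le> b" "b \<le> c"
    then show "tr (bars J) b c (tr (bars J) a b f) = tr (bars J) a c f"
      unfolding tr_bars using is_interval_between[OF J, of a _ c b] by (intro ext) auto
  qed
qed

definition unit_vec :: "nat \<Rightarrow> nat \<Rightarrow> 'k::field" where
  "unit_vec i = (\<lambda>j. if j = i then 1 else 0)"

lemma unit_vec_in_fib: "unit_vec i \<in> fib (bars J) a \<longleftrightarrow> a \<in> J i"
  unfolding fib_bars unit_vec_def by auto

lemma tr_unit_vec: "a \<in> J i \<Longrightarrow> b \<in> J i \<Longrightarrow> tr (bars J) a b (unit_vec i) = unit_vec i"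
  unfolding tr_bars unit_vec_def by auto

lemma inj_unit_vec: "inj (unit_vec :: nat \<Rightarrow> nat \<Rightarrow> 'k::field)"
  unfolding inj_def unit_vec_def by (metis zero_neq_one)

lemma sum_fun_apply: "sum f A x = (\<Sum>i\<in>A. f i x)" for f :: "'i \<Rightarrow> 'a \<Rightarrow> 'b::comm_monoid_add"
  by (induction A rule: infinite_finite_induct) auto

context
begin

interpretation V: vector_space "\<lambda>(c :: 'k::field) (f :: nat \<Rightarrow> 'k) i. c * f i"
  by (rule vector_space_coordinatewise)

lemma finite_support_eq_sum_unit_vec:
  fixes f :: "nat \<Rightarrow> 'k::field"
  assumes "finite {i. f i \<noteq> 0}"
  shows "f = (\<Sum>i | f i \<noteq> 0. (\<lambda>j. f i * unit_vec i j))"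
proof
  fix j
  have "(\<Sum>i | f i \<noteq> 0. (\<lambda>j. f i * unit_vec i j)) j = (\<Sum>i | f i \<noteq> 0. if i = j then f i else 0)"
    unfolding sum_fun_apply unit_vec_def by (intro sum.cong) auto
  also have "\<dots> = f j" using assms by (subst sum.delta) auto
  finally show "f j = (\<Sum>i | f i \<noteq> 0. (\<lambda>j. f i * unit_vec i j)) j" ..
qed

lemma independent_unit_vec: "V.independent (range unit_vec :: (nat \<Rightarrow> 'k::field) set)"
proof -
  have z: "c i = 0" if "finite T" "i \<in> T" "(\<Sum>i\<in>T. (\<lambda>j. c i * unit_vec i j)) = 0"
    for c :: "nat \<Rightarrow> 'k" and i T
  proof -
    have "0 = (\<Sum>i\<in>T. (\<lambda>j. c i * unit_vec i j)) i" using that(3) by simp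
    also have "\<dots> = c i"
      using that(1,2) by (simp add: sum_fun_apply unit_vec_def if_distrib cong: if_cong)
    finally show ?thesis by simp
  qed
  show ?thesis
    unfolding V.independent_explicit_module
  proof (intro allI impI)
    fix t :: "(nat \<Rightarrow> 'k) set" and u v
    assume t: "finite t" "t \<subseteq> range unit_vec" "(\<Sum>v\<in>t. (\<lambda>i. u v * v i)) = 0" "v \<in> t"
    define T where "T = unit_vec -` t"
    have tT: "t = unit_vec ` T" unfolding T_def using t(2) by auto
    have inj: "inj_on (unit_vec :: nat \<Rightarrow> nat \<Rightarrow> 'k) T" using inj_unit_vec by (rule inj_on_subset) simp
    have fT: "finite T" using t(1) inj unfolding tT by (simp add: finite_image_iff)
    obtain i where i: "i \<in> T" "v = unit_vec i" using t(4) unfolding tT by blast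
    have "(\<Sum>v\<in>t. (\<lambda>i. u v * v i)) = (\<Sum>i\<in>T. (\<lambda>j. u (unit_vec i) * unit_vec i j))"
      unfolding tT by (subst sum.reindex[OF inj]) simp
    then have "u (unit_vec i) = 0" using z[OF fT i(1), of "\<lambda>i. u (unit_vec i)"] t(3) by simp
    then show "u v = 0" using i by simp
  qed
qed

text \<open>
  A rank inequality between barcode modules is a bound on the number of unit vectors in a span.
\<close>

lemma card_le_if_unit_vec_in_span:
  fixes B :: "(nat \<Rightarrow> 'k::field) set"
  assumes "finite B" "unit_vec ` A \<subseteq> V.span B"
  shows "finite A \<and> card A \<le> card B"
proof -
  have "V.independent (unit_vec ` A)"
    using independent_unit_vec by (rule V.independent_mono) blast
  then have "finite (unit_vec ` A :: (nat \<Rightarrow> 'k) set) \<and> card (unit_vec ` A :: (nat \<Rightarrow> 'k) set) \<le> card B"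
    using assms V.independent_span_bound by blast
  moreover have "inj_on (unit_vec :: nat \<Rightarrow> nat \<Rightarrow> 'k) A" using inj_unit_vec by (rule inj_on_subset) simp
  ultimately show ?thesis by (simp add: card_image finite_image_iff)
qed

lemma finite_support_in_span:
  fixes f :: "nat \<Rightarrow> 'k::field"
  assumes "finite {i. f i \<noteq> 0}" "{i. f i \<noteq> 0} \<subseteq> A"
  shows "f \<in> V.span (unit_vec ` A)"
proof (subst finite_support_eq_sum_unit_vec[OF assms(1)], rule V.span_sum, rule V.span_scale)
  fix i assume "i \<in> {i. f i \<noteq> 0}"
  then show "unit_vec i \<in> V.span (unit_vec ` A :: (nat \<Rightarrow> 'k) set)"
    using assms(2) by (intro V.span_base) blast
qed

end

section \<open>Ranks of interleaved modules\<close>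

text \<open>
  The hypotheses are relative to a subspace \<open>V\<close> because the morphisms in question are linear only on
  the fibres.
\<close>

lemma linear_between_span:
  fixes s1 :: "'k::field \<Rightarrow> 'v::ab_group_add \<Rightarrow> 'v" and s2 :: "'k \<Rightarrow> 'w::ab_group_add \<Rightarrow> 'w"
  assumes "vector_space s1" "vector_space s2" "linear_between s1 s2 V W f"
    and V: "module.subspace s1 V" and T: "T \<subseteq> V"
  shows "f ` module.span s1 T = module.span s2 (f ` T)"
proof -
  interpret A: vector_space s1 by fact
  interpret B: vector_space s2 by fact
  have add: "f (x + y) = f x + f y" if "x \<in> V" "y \<in> V" for x y
    using assms(3) that unfolding linear_between_def by blast
  have scale: "f (s1 c x) = s2 c (f x)" if "x \<in> V" for c x
    using assms(3) that unfolding linear_between_def by blast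
  have sub: "A.span T \<subseteq> V" using T V by (rule A.span_minimal)
  have 0: "f 0 = 0" using scale[of 0 0] A.subspace_0[OF V] by simp
  show ?thesis
  proof
    have "f x \<in> B.span (f ` T)" if "x \<in> A.span T" for x
    proof -
      from that have "x \<in> V \<and> f x \<in> B.span (f ` T)"
      proof (rule A.span_induct)
        show "A.subspace {x. x \<in> V \<and> f x \<in> B.span (f ` T)}"
          using V 0 by (auto simp: A.subspace_def add scale B.span_zero B.span_add B.span_scale)
        show "y \<in> V \<and> f y \<in> B.span (f ` T)" if "y \<in> T" for y
          using that T by (auto intro: B.span_base)
      qed
      then show ?thesis ..
    qed
    then show "f ` A.span T \<subseteq> B.span (f ` T)" by blast
    have "B.subspace (f ` A.span T)"
    proof (rule B.subspaceI)
      show "0 \<in> f ` A.span T" using 0 A.span_zero by (metis imageI)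
    next
      fix x y assume "x \<in> f ` A.span T" "y \<in> f ` A.span T"
      then show "x + y \<in> f ` A.span T"
        using sub add A.span_add by (smt (verit) image_iff subset_eq)
    next
      fix c x assume "x \<in> f ` A.span T"
      then show "s2 c x \<in> f ` A.span T"
        using sub scale A.span_scale by (smt (verit) image_iff subset_eq)
    qed
    moreover have "f ` T \<subseteq> f ` A.span T" using A.span_superset by blast
    ultimately show "B.span (f ` T) \<subseteq> f ` A.span T" by (intro B.span_minimal)
  qed
qed

lemma persistence_module_space: "persistence_module M \<Longrightarrow> vector_space (smul M)"
  unfolding persistence_module_def by blast

lemma persistence_module_fib: "persistence_module M \<Longrightarrow> module.subspace (smul M) (fib M a)"
  unfolding persistence_module_def by blast

lemma shift_hom_linear:
  "shift_hom e M N \<phi> \<Longrightarrow> linear_between (smul M) (smul N) (fib M a) (fib N (a + e)) (\<phi> a)"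
  unfolding shift_hom_def by blast

lemma qtame_isomorphic:
  assumes M: "persistence_module M" and N: "persistence_module N"
    and "interleaved 0 M N" and "qtame M"
  shows "qtame N"
  unfolding qtame_def
proof (intro allI impI)
  fix a b :: real assume ab: "a < b"
  obtain \<phi> \<psi> where f: "shift_hom 0 M N \<phi>" "shift_hom 0 N M \<psi>"
    and inv: "\<And>a y. y \<in> fib N a \<Longrightarrow> \<phi> a (\<psi> a y) = y"
    using assms(3) tr_id[OF N] unfolding interleaved_def by auto
  obtain B where B: "finite B" "tr M a b ` fib M a = module.span (smul M) B"
    using assms(4) ab unfolding qtame_def by blast
  have sub: "B \<subseteq> fib M b"
  proof -
    have "B \<subseteq> module.span (smul M) B"
      using persistence_module_space[OF M]
      by (simp add: module.span_superset module_iff_vector_space)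
    also have "\<dots> \<subseteq> fib M b" using B(2) tr_in[OF M] ab by (metis image_subsetI less_imp_le)
    finally show ?thesis .
  qed
  have surj: "fib N a = \<phi> a ` fib M a"
    using inv shift_hom_in[OF f(1), of _ a] shift_hom_in[OF f(2), of _ a] by force
  have "tr N a b ` fib N a = \<phi> b ` tr M a b ` fib M a"
    unfolding surj image_image using shift_hom_natural[OF f(1), of a b] ab by auto
  also have "\<dots> = module.span (smul N) (\<phi> b ` B)"
    unfolding B(2)
    by (rule linear_between_span[OF persistence_module_space[OF M] persistence_module_space[OF N]
          shift_hom_linear[OF f(1)] persistence_module_fib[OF M] sub])
  finally show "\<exists>B. finite B \<and> tr N a b ` fib N a = module.span (smul N) B"
    using B(1) by blast
qed

text \<open>
  The map from \<open>a\<close> to \<open>b\<close> is the projection onto the bars that contain both points, so its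
  image has these bars as a basis.
\<close>

lemma qtame_bars_iff:
  assumes J: "\<And>i. is_interval (J i)"
  shows "qtame (bars J :: 'k::field upmod) \<longleftrightarrow> (\<forall>a b. a < b \<longrightarrow> finite {i. a \<in> J i \<and> b \<in> J i})"
proof (intro iffI allI impI)
  fix a b :: real
  assume "qtame (bars J :: 'k upmod)" "a < b"
  then obtain B where B: "finite B"
    "tr (bars J :: 'k upmod) a b ` fib (bars J) a = module.span (smul (bars J)) B"
    unfolding qtame_def by blast
  have "(unit_vec i :: nat \<Rightarrow> 'k) \<in> module.span (smul (bars J)) B" if "a \<in> J i" "b \<in> J i" for i
  proof -
    have "tr (bars J :: 'k upmod) a b (unit_vec i) \<in> tr (bars J) a b ` fib (bars J) a"
      using that by (intro imageI) (simp add: unit_vec_in_fib)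
    then show ?thesis using that by (simp add: B(2) tr_unit_vec)
  qed
  then have "unit_vec ` {i. a \<in> J i \<and> b \<in> J i} \<subseteq> module.span (\<lambda>c f i. c * f i) B"
    unfolding smul_bars by blast
  from card_le_if_unit_vec_in_span[OF B(1) this] show "finite {i. a \<in> J i \<and> b \<in> J i}" ..
next
  assume fin: "\<forall>a b. a < b \<longrightarrow> finite {i. a \<in> J i \<and> b \<in> J i}"
  show "qtame (bars J :: 'k upmod)"
    unfolding qtame_def
  proof (intro allI impI)
    fix a b :: real assume ab: "a < b"
    let ?A = "{i. a \<in> J i \<and> b \<in> J i}" and ?M = "bars J :: 'k upmod"
    let ?B = "unit_vec ` ?A :: (nat \<Rightarrow> 'k) set"
    note M = persistence_module_bars[OF J, where 'k = 'k]
    have B: "?B \<subseteq> fib ?M a" by (auto simp: unit_vec_in_fib)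
    have "tr ?M a b ` module.span (smul ?M) ?B = module.span (smul ?M) (tr ?M a b ` ?B)"
      using M ab B unfolding persistence_module_def
      by (intro linear_between_span[where V = "fib ?M a" and W = "fib ?M b"]) auto
    also have "tr ?M a b ` ?B = ?B" unfolding image_image by (simp add: tr_unit_vec)
    finally have 1: "module.span (smul ?M) ?B = tr ?M a b ` module.span (smul ?M) ?B" ..
    have "module.span (smul ?M) ?B \<subseteq> fib ?M a"
      by (intro module.span_minimal[OF _ B persistence_module_fib[OF M]])
        (simp add: module_iff_vector_space persistence_module_space[OF M])
    then have 2: "module.span (smul ?M) ?B \<subseteq> tr ?M a b ` fib ?M a" using 1 by blast
    have "tr ?M a b ` fib ?M a \<subseteq> module.span (smul ?M) ?B"
    proof
      fix g assume "g \<in> tr ?M a b ` fib ?M a"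
      then obtain f where f: "f \<in> fib ?M a" "g = tr ?M a b f" by blast
      show "g \<in> module.span (smul ?M) ?B"
        unfolding smul_bars
      proof (rule finite_support_in_span)
        show "finite {i. g i \<noteq> 0}"
          using f unfolding fib_bars tr_bars by (auto elim!: rev_finite_subset)
        show "{i. g i \<noteq> 0} \<subseteq> ?A" using f unfolding tr_bars by auto
      qed
    qed
    with 2 fin ab show "\<exists>B. finite B \<and> tr ?M a b ` fib ?M a = module.span (smul ?M) B"
      by (intro exI[of _ ?B]) simp
  qed
qed

text \<open>
  The map of \<open>bars J\<close> from \<open>a\<close> to \<open>b\<close> factors as \<open>\<psi> \<circ> tr \<circ> \<phi>\<close> through the map of \<open>bars J'\<close> from
  \<open>a + d\<close> to \<open>b - d\<close>; the two cardinalities are the ranks of these maps.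
\<close>

lemma rank_le_of_interleaved:
  assumes J: "\<And>i. is_interval (J i)" and J': "\<And>i. is_interval (J' i)"
    and d: "0 \<le> d" and ab: "a + 2 * d \<le> b"
    and int: "interleaved d (bars J :: 'k::field upmod) (bars J')"
    and fin: "finite {i. a + d \<in> J' i \<and> b - d \<in> J' i}"
  shows "finite {i. a \<in> J i \<and> b \<in> J i} \<and>
    card {i. a \<in> J i \<and> b \<in> J i} \<le> card {i. a + d \<in> J' i \<and> b - d \<in> J' i}"
proof -
  let ?M = "bars J :: 'k upmod" and ?N = "bars J' :: 'k upmod"
  let ?B = "{i. a + d \<in> J' i \<and> b - d \<in> J' i}"
  let ?E = "unit_vec ` ?B :: (nat \<Rightarrow> 'k) set"
  note M = persistence_module_bars[OF J, where 'k = 'k]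
  note N = persistence_module_bars[OF J', where 'k = 'k]
  obtain \<phi> \<psi> where f: "shift_hom d ?M ?N \<phi>" "shift_hom d ?N ?M \<psi>"
     "\<And>a x. x \<in> fib ?M a \<Longrightarrow> \<psi> (a + d) (\<phi> a x) = tr ?M a (a + 2 * d) x"
    using int unfolding interleaved_def by blast
  have E: "?E \<subseteq> fib ?N (b - d)" by (auto simp: unit_vec_in_fib)
  have span: "\<psi> (b - d) ` module.span (smul ?N) ?E = module.span (smul ?M) (\<psi> (b - d) ` ?E)"
    using linear_between_span[OF persistence_module_space[OF N] persistence_module_space[OF M]
          shift_hom_linear[OF f(2)] persistence_module_fib[OF N] E] .
  have "(unit_vec i :: nat \<Rightarrow> 'k) \<in> module.span (smul ?M) (\<psi> (b - d) ` ?E)"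
    if i: "a \<in> J i" "b \<in> J i" for i
  proof -
    let ?u = "unit_vec i :: nat \<Rightarrow> 'k"
    define g where "g = tr ?N (a + d) (b - d) (\<phi> a ?u)"
    have u: "?u \<in> fib ?M a" using i by (simp add: unit_vec_in_fib)
    have u': "tr ?M a (b - 2 * d) ?u \<in> fib ?M (b - 2 * d)" using u ab by (intro tr_in[OF M]) auto
    have g: "g = \<phi> (b - 2 * d) (tr ?M a (b - 2 * d) ?u)"
      using shift_hom_natural[OF f(1) _ u, of "b - 2 * d"] ab unfolding g_def
      by (simp add: algebra_simps)
    have "\<psi> (b - d) g = tr ?M (b - 2 * d) b (tr ?M a (b - 2 * d) ?u)"
      using f(3)[OF u'] unfolding g by (simp add: algebra_simps)
    also have "\<dots> = tr ?M a b ?u" using ab d by (intro tr_tr[OF M _ _ u]) auto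
    also have "\<dots> = ?u" using i by (rule tr_unit_vec)
    finally have "\<psi> (b - d) g = ?u" .
    moreover have "g \<in> module.span (smul ?N) ?E"
      unfolding smul_bars
    proof (rule finite_support_in_span)
      have "\<phi> a ?u \<in> fib ?N (a + d)" using f(1) u by (rule shift_hom_in)
      then show "finite {i. g i \<noteq> 0}"
        unfolding g_def fib_bars tr_bars by (auto elim!: rev_finite_subset)
      show "{i. g i \<noteq> 0} \<subseteq> ?B" unfolding g_def tr_bars by auto
    qed
    ultimately show ?thesis unfolding span[symmetric] by (metis imageI)
  qed
  then have "unit_vec ` {i. a \<in> J i \<and> b \<in> J i} \<subseteq> module.span (smul ?M) (\<psi> (b - d) ` ?E)" by blast
  moreover have "finite (\<psi> (b - d) ` ?E)" using fin by simp
  ultimately have "finite {i. a \<in> J i \<and> b \<in> J i} \<and>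
      card {i. a \<in> J i \<and> b \<in> J i} \<le> card (\<psi> (b - d) ` ?E)"
    unfolding smul_bars by (rule card_le_if_unit_vec_in_span[rotated])
  moreover have "card (\<psi> (b - d) ` ?E) \<le> card ?B"
    using card_image_le[of ?E "\<psi> (b - d)"] card_image_le[OF fin, of "unit_vec :: nat \<Rightarrow> nat \<Rightarrow> 'k"] fin
    by auto
  ultimately show ?thesis by linarith
qed

section \<open>Erosion closeness of intervals\<close>

text \<open>
  For intervals longer than \<open>2 * e\<close> this bounds the differences of corresponding endpoints by \<open>e\<close>;
  intervals of length less than \<open>2 * e\<close> are close to each other and to the empty set.  This
  covers infinite endpoints, all kinds of finite endpoints and vanishing bars at once.
\<close>

definition erosion_close :: "real \<Rightarrow> real set \<Rightarrow> real set \<Rightarrow> bool" where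
  "erosion_close e J J' \<longleftrightarrow>
    (\<forall>x. x - e \<in> J \<and> x + e \<in> J \<longrightarrow> x \<in> J') \<and> (\<forall>x. x - e \<in> J' \<and> x + e \<in> J' \<longrightarrow> x \<in> J)"

lemma erosion_closeI:
  assumes "\<And>x. x - e \<in> J \<Longrightarrow> x + e \<in> J \<Longrightarrow> x \<in> J'"
    and "\<And>x. x - e \<in> J' \<Longrightarrow> x + e \<in> J' \<Longrightarrow> x \<in> J"
  shows "erosion_close e J J'"
  unfolding erosion_close_def using assms by blast

lemma erosion_closeD: "erosion_close e J J' \<Longrightarrow> x - e \<in> J \<Longrightarrow> x + e \<in> J \<Longrightarrow> x \<in> J'"
  unfolding erosion_close_def by blast

lemma erosion_close_sym: "erosion_close e J J' \<Longrightarrow> erosion_close e J' J"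
  unfolding erosion_close_def by blast

lemma erosion_close_refl:
  assumes "is_interval J" "0 \<le> e"
  shows "erosion_close e J J"
proof -
  have "x \<in> J" if "x - e \<in> J" "x + e \<in> J" for x
    using assms(2) by (intro is_interval_between[OF assms(1) that]) auto
  then show ?thesis by (intro erosion_closeI)
qed

lemma erosion_close_trans:
  assumes J: "is_interval J" and J'': "is_interval J''" and e: "0 \<le> e" "0 \<le> e'"
    and c: "erosion_close e J J'" and c': "erosion_close e' J' J''"
  shows "erosion_close (e + e') J J''"
proof (rule erosion_closeI)
  fix x assume x: "x - (e + e') \<in> J" "x + (e + e') \<in> J"
  have "y \<in> J'" if "\<bar>y - x\<bar> \<le> e'" for y
    by (rule erosion_closeD[OF c]; rule is_interval_between[OF J x]) (use that e in auto)
  then show "x \<in> J''" using e by (intro erosion_closeD[OF c']) auto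
next
  fix x assume x: "x - (e + e') \<in> J''" "x + (e + e') \<in> J''"
  have "y \<in> J'" if "\<bar>y - x\<bar> \<le> e" for y
    by (rule erosion_closeD[OF erosion_close_sym[OF c']]; rule is_interval_between[OF J'' x])
      (use that e in auto)
  then show "x \<in> J" using e by (intro erosion_closeD[OF erosion_close_sym[OF c]]) auto
qed

lemma erosion_close_mono:
  assumes "is_interval J" "is_interval J'" "0 \<le> e" "e \<le> e'" "erosion_close e J J'"
  shows "erosion_close e' J J'"
  using erosion_close_trans[OF assms(1,2,3) _ assms(5) erosion_close_refl[OF assms(2)], of "e' - e"] assms(4)
  by simp

lemma bounded_erosion_close:
  assumes J': "is_interval J'" and c: "erosion_close e J J'" and "0 \<le> e" and "bounded J"
  shows "bounded J'"
proof (cases "J' = {}")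
  case False
  then obtain z where z: "z \<in> J'" by blast
  obtain B where B: "\<And>x. x \<in> J \<Longrightarrow> \<bar>x\<bar> \<le> B"
    using \<open>bounded J\<close> unfolding bounded_iff by auto
  have "\<bar>y\<bar> \<le> \<bar>z\<bar> + 2 * e + \<bar>B\<bar>" if y: "y \<in> J'" for y
  proof (rule ccontr)
    assume far: "\<not> ?thesis"
    have c': "x - e \<in> J' \<Longrightarrow> x + e \<in> J' \<Longrightarrow> x \<in> J" for x
      by (rule erosion_closeD[OF erosion_close_sym[OF c]])
    \<comment> \<open>Far from \<open>z\<close>, a step of length \<open>e\<close> from \<open>y\<close> towards \<open>z\<close> leads into the bounded set \<open>J\<close>.\<close>
    show False
    proof (cases "y < z")
      case True
      have "y + e + e \<in> J'" using True far \<open>0 \<le> e\<close> by (intro is_interval_between[OF J' y z]) auto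
      then have "y + e \<in> J" using y by (intro c') auto
      from B[OF this] show False using True far \<open>0 \<le> e\<close> by auto
    next
      case False
      have "y - e - e \<in> J'" using False far \<open>0 \<le> e\<close> by (intro is_interval_between[OF J' z y]) auto
      then have "y - e \<in> J" using y by (intro c') auto
      from B[OF this] show False using False far \<open>0 \<le> e\<close> by auto
    qed
  qed
  then show ?thesis unfolding bounded_iff by auto
qed simp

text \<open>
  These two conditions say that the identity on the overlap of \<open>J\<close> with the translate \<open>J' - e\<close> is
  natural: the overlap is a final part of one interval and an initial part of the other.  They can
  fail if both intervals are short, hence the hypothesis that one of them survives erosion.
\<close>

lemma erosion_close_hom:
  assumes J: "is_interval J" and J': "is_interval J'" and e: "0 \<le> e" and c: "erosion_close e J J'"
    and long: "\<exists>z. z - e \<in> J \<and> z + e \<in> J \<or> z - e \<in> J' \<and> z + e \<in> J'"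
    and ab: "a \<le> b"
  shows "a \<in> J \<Longrightarrow> b \<in> J \<Longrightarrow> b + e \<in> J' \<Longrightarrow> a + e \<in> J'"
    and "a \<in> J \<Longrightarrow> a + e \<in> J' \<Longrightarrow> b + e \<in> J' \<Longrightarrow> b \<in> J"
proof -
  note bJ = is_interval_between[OF J] and bJ' = is_interval_between[OF J']
  have c1: "x - e \<in> J \<Longrightarrow> x + e \<in> J \<Longrightarrow> x \<in> J'" and c2: "x - e \<in> J' \<Longrightarrow> x + e \<in> J' \<Longrightarrow> x \<in> J" for x
    by (fact erosion_closeD[OF c], fact erosion_closeD[OF erosion_close_sym[OF c]])
  obtain z where "z - e \<in> J \<and> z + e \<in> J \<or> z - e \<in> J' \<and> z + e \<in> J'" using long by blast
  then have z: "z - e \<in> J \<and> z + e \<in> J \<and> z \<in> J' \<or> z - e \<in> J' \<and> z + e \<in> J' \<and> z \<in> J"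
    using c1[of z] c2[of z] by metis
  show "a + e \<in> J'" if "a \<in> J" "b \<in> J" "b + e \<in> J'"
  proof (cases "z - e \<in> J \<and> z + e \<in> J \<and> z \<in> J'")
    case True
    show ?thesis
    proof (cases "z \<le> a + e")
      case le: True
      show ?thesis using True le ab that by - (rule bJ'[of z "b + e"]; auto)
    next
      case False
      \<comment> \<open>Now \<open>a\<close> and \<open>a + 2 * e\<close> lie in \<open>J\<close>, so that closeness puts the point halfway into \<open>J'\<close>.\<close>
      then have "a + e + e \<in> J" using True e that by - (rule bJ[of a "z + e"]; auto)
      then show ?thesis using that by (intro c1) auto
    qed
  next
    case False
    with z have z': "z - e \<in> J'" "z + e \<in> J'" "z \<in> J" by auto
    show ?thesis
    proof (cases "z - e \<le> a + e")
      case le: True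
      show ?thesis using z' le ab that by - (rule bJ'[of "z - e" "b + e"]; auto)
    next
      case False
      then have "a + e + e \<in> J" using z' e that by - (rule bJ[of a z]; auto)
      then show ?thesis using that by (intro c1) auto
    qed
  qed
  show "b \<in> J" if "a \<in> J" "a + e \<in> J'" "b + e \<in> J'"
  proof (cases "z - e \<in> J \<and> z + e \<in> J \<and> z \<in> J'")
    case True
    show ?thesis
    proof (cases "b \<le> z + e")
      case le: True
      show ?thesis using True le ab that by - (rule bJ[of a "z + e"]; auto)
    next
      case False
      then have "b - e \<in> J'" using True e that by - (rule bJ'[of z "b + e"]; auto)
      then show ?thesis using that by (intro c2) auto
    qed
  next
    case False
    with z have z': "z - e \<in> J'" "z + e \<in> J'" "z \<in> J" by auto
    show ?thesis
    proof (cases "b \<le> z")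
      case le: True
      show ?thesis using z' le ab that by - (rule bJ[of a z]; auto)
    next
      case False
      then have "b - e \<in> J'" using z' e that by - (rule bJ'[of "z - e" "b + e"]; auto)
      then show ?thesis using that by (intro c2) auto
    qed
  qed
qed

text \<open>
  On pairs of short bars this is zero, because the partial identity need not be natural there.
\<close>

definition bar_shift :: "real \<Rightarrow> (nat \<Rightarrow> real set) \<Rightarrow> (nat \<Rightarrow> real set) \<Rightarrow> real \<Rightarrow> (nat \<Rightarrow> 'k::field) \<Rightarrow> nat \<Rightarrow> 'k" where
  "bar_shift e J J' a f = (\<lambda>i.
     if (\<exists>z. z - e \<in> J i \<and> z + e \<in> J i \<or> z - e \<in> J' i \<and> z + e \<in> J' i) \<and> a \<in> J i \<and> a + e \<in> J' i
     then f i else 0)"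

lemma shift_hom_bar_shift:
  assumes J: "\<And>i. is_interval (J i)" and J': "\<And>i. is_interval (J' i)" and e: "0 \<le> e"
    and c: "\<And>i. erosion_close e (J i) (J' i)"
  shows "shift_hom e (bars J :: 'k::field upmod) (bars J') (bar_shift e J J')"
  unfolding shift_hom_def
proof (intro conjI allI impI ballI)
  fix a b :: real and f :: "nat \<Rightarrow> 'k"
  show "linear_between (smul (bars J)) (smul (bars J')) (fib (bars J :: 'k upmod) a)
      (fib (bars J' :: 'k upmod) (a + e)) (bar_shift e J J' a)"
    unfolding linear_between_def smul_bars fib_bars bar_shift_def
    by (auto simp: fun_eq_iff intro: finite_support_if split: if_splits)
  assume ab: "a \<le> b" and f: "f \<in> fib (bars J) a"
  show "bar_shift e J J' b (tr (bars J) a b f) = tr (bars J') (a + e) (b + e) (bar_shift e J J' a f)"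
  proof
    fix i
    show "bar_shift e J J' b (tr (bars J) a b f) i =
        tr (bars J') (a + e) (b + e) (bar_shift e J J' a f) i"
      using erosion_close_hom[OF J J' e c _ ab, of i]
      unfolding bar_shift_def tr_bars by (simp only: split: if_split) blast
  qed
qed

text \<open>
  The easy half of stability.  If \<open>a\<close> and \<open>a + 2 * e\<close> lie in a bar, then this bar survives erosion
  and its partner contains \<open>a + e\<close>, so the composite is the identity exactly where it has to be.
\<close>

lemma interleaved_bars:
  assumes J: "\<And>i. is_interval (J i)" and J': "\<And>i. is_interval (J' i)" and e: "0 \<le> e"
    and c: "\<And>i. erosion_close e (J i) (J' i)"
  shows "interleaved e (bars J :: 'k::field upmod) (bars J')"
proof -
  have comp: "bar_shift e J2 J1 (a + e) (bar_shift e J1 J2 a f) = tr (bars J1) a (a + 2 * e) f"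
    if c: "\<And>i. erosion_close e (J1 i) (J2 i)" for J1 J2 a and f :: "nat \<Rightarrow> 'k"
  proof
    fix i
    have eq: "a + e - e = a" "a + e + e = a + 2 * e" by auto
    show "bar_shift e J2 J1 (a + e) (bar_shift e J1 J2 a f) i = tr (bars J1) a (a + 2 * e) f i"
    proof (cases "a \<in> J1 i \<and> a + 2 * e \<in> J1 i")
      case True
      then have "a + e \<in> J2 i" by (intro erosion_closeD[OF c]) (simp_all add: eq)
      moreover have "\<exists>z. z - e \<in> J1 i \<and> z + e \<in> J1 i"
        using True by (intro exI[of _ "a + e"]) (simp add: eq)
      ultimately show ?thesis using True unfolding bar_shift_def tr_bars eq by auto
    next
      case False
      then show ?thesis unfolding bar_shift_def tr_bars eq by simp
    qed
  qed
  have c': "erosion_close e (J' i) (J i)" for i using c by (rule erosion_close_sym)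
  show ?thesis
    unfolding interleaved_def
    using shift_hom_bar_shift[of J J', OF J J' e c] shift_hom_bar_shift[of J' J, OF J' J e c']
      comp[of J J', OF c] comp[of J' J, OF c'] by blast
qed

lemma interleaved_bars_reindex:
  assumes inj: "inj \<sigma>" and K': "\<And>j. K' (\<sigma> j) = K j" "\<And>i. i \<notin> range \<sigma> \<Longrightarrow> K' i = {}"
  shows "interleaved 0 (bars K :: 'k::field upmod) (bars K')"
proof -
  define \<phi> :: "real \<Rightarrow> (nat \<Rightarrow> 'k) \<Rightarrow> nat \<Rightarrow> 'k"
    where "\<phi> = (\<lambda>a f i. if i \<in> range \<sigma> then f (inv \<sigma> i) else 0)"
  define \<psi> :: "real \<Rightarrow> (nat \<Rightarrow> 'k) \<Rightarrow> nat \<Rightarrow> 'k" where "\<psi> = (\<lambda>a g j. g (\<sigma> j))"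
  have fin1: "finite {i. \<phi> a f i \<noteq> 0}" if "finite {j. f j \<noteq> 0}" for a f
  proof (rule finite_subset)
    show "{i. \<phi> a f i \<noteq> 0} \<subseteq> \<sigma> ` {j. f j \<noteq> 0}"
      unfolding \<phi>_def using inj by auto
  qed (use that in simp)
  have fin2: "finite {j. g (\<sigma> j) \<noteq> 0}" if "finite {i. g i \<noteq> (0::'k)}" for g
    using finite_vimageI[OF that inj] by (simp add: vimage_def)
  have \<phi>\<sigma>: "\<phi> a f (\<sigma> j) = f j" for a f j unfolding \<phi>_def using inj by simp
  have \<phi>0: "\<phi> a f i = 0" if "i \<notin> range \<sigma>" for a f i unfolding \<phi>_def using that by simp
  have ext: "u = v" if "\<And>j. u (\<sigma> j) = v (\<sigma> j)" "\<And>i. i \<notin> range \<sigma> \<Longrightarrow> u i = v i" for u v :: "nat \<Rightarrow> 'k"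
    using that by (metis ext rangeE)
  have "shift_hom 0 (bars K :: 'k upmod) (bars K') \<phi>"
    unfolding shift_hom_def linear_between_def smul_bars fib_bars tr_bars
  proof (intro conjI allI impI ballI subsetI)
    fix a :: real and g
    assume "g \<in> \<phi> a ` {f. finite {i. f i \<noteq> 0} \<and> (\<forall>i. f i \<noteq> 0 \<longrightarrow> a \<in> K i)}"
    then obtain f where f: "finite {i. f i \<noteq> 0}" "\<And>i. f i \<noteq> 0 \<Longrightarrow> a \<in> K i" and g: "g = \<phi> a f" by blast
    have "a \<in> K' i" if "g i \<noteq> 0" for i
    proof (cases "i \<in> range \<sigma>")
      case True then show ?thesis using that f(2) unfolding g by (auto simp: \<phi>\<sigma> K'(1))
    next
      case False then show ?thesis using that unfolding g by (simp add: \<phi>0)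
    qed
    then show "g \<in> {f. finite {i. f i \<noteq> 0} \<and> (\<forall>i. f i \<noteq> 0 \<longrightarrow> a + 0 \<in> K' i)}"
      using fin1[OF f(1)] unfolding g by simp
  qed (rule ext; simp add: \<phi>\<sigma> \<phi>0 K'; fail)+
  moreover have "shift_hom 0 (bars K' :: 'k upmod) (bars K) \<psi>"
    unfolding shift_hom_def linear_between_def smul_bars fib_bars tr_bars \<psi>_def
    using fin2 by (auto simp: fun_eq_iff K'(1))
  moreover have "\<psi> (a + 0) (\<phi> a f) = tr (bars K) a (a + 2 * 0) f" if "f \<in> fib (bars K) a" for a f
    using that unfolding \<psi>_def by (auto simp: fun_eq_iff \<phi>\<sigma> tr_bars fib_bars)
  moreover have "\<phi> (a + 0) (\<psi> a g) = tr (bars K') a (a + 2 * 0) g" if "g \<in> fib (bars K') a" for a g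
    using that by (intro ext) (auto simp: \<psi>_def \<phi>\<sigma> \<phi>0 tr_bars fib_bars K')
  ultimately show ?thesis unfolding interleaved_def by blast
qed

section \<open>Matching families with equal incidence counts\<close>

lemma decseq_finite_eventually_Inter:
  fixes A :: "nat \<Rightarrow> 'a set"
  assumes "finite (A 0)" "decseq A"
  shows "\<forall>\<^sub>F n in sequentially. A n = (\<Inter>n. A n)"
proof -
  have "\<forall>x\<in>A 0. \<forall>\<^sub>F n in sequentially. x \<in> A n \<longrightarrow> x \<in> (\<Inter>n. A n)"
  proof
    fix x
    show "\<forall>\<^sub>F n in sequentially. x \<in> A n \<longrightarrow> x \<in> (\<Inter>n. A n)"
    proof (cases "x \<in> (\<Inter>n. A n)")
      case False
      then obtain N where "x \<notin> A N" by blast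
      then have "\<forall>n\<ge>N. x \<notin> A n" using decseqD[OF assms(2)] by blast
      then show ?thesis unfolding eventually_sequentially by blast
    qed simp
  qed
  then have "\<forall>\<^sub>F n in sequentially. \<forall>x\<in>A 0. x \<in> A n \<longrightarrow> x \<in> (\<Inter>n. A n)"
    using assms(1) by (simp only: eventually_ball_finite_distrib)
  then show ?thesis
    by (rule eventually_mono) (use decseqD[OF assms(2), of 0] in blast)
qed

text \<open>
  Inclusion-exclusion: the number of sets that contain \<open>U\<close> and avoid \<open>V\<close> is determined by the
  numbers of sets that contain given finite sets.  The sets \<open>U\<close> stay nonempty throughout, since the
  number of all sets may be infinite.
\<close>

lemma card_avoiding_eq:
  fixes S :: "'i \<Rightarrow> 'a set" and T :: "'i \<Rightarrow> 'a set"
  assumes up: "\<And>U. finite U \<Longrightarrow> U \<noteq> {} \<Longrightarrow>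
      finite {i. U \<subseteq> S i} \<and> finite {j. U \<subseteq> T j} \<and> card {i. U \<subseteq> S i} = card {j. U \<subseteq> T j}"
    and "finite V" "finite U" "U \<noteq> {}"
  shows "card {i. U \<subseteq> S i \<and> V \<inter> S i = {}} = card {j. U \<subseteq> T j \<and> V \<inter> T j = {}}"
  using assms(2-)
proof (induction V arbitrary: U rule: finite_induct)
  case empty
  then show ?case using up by simp
next
  case (insert v V)
  have eq: "card {i. U \<subseteq> R i \<and> insert v V \<inter> R i = {}} =
      card {i. U \<subseteq> R i \<and> V \<inter> R i = {}} - card {i. insert v U \<subseteq> R i \<and> V \<inter> R i = {}}"
    if "finite {i. insert v U \<subseteq> R i}" for R :: "'i \<Rightarrow> 'a set"
  proof -
    have "{i. U \<subseteq> R i \<and> insert v V \<inter> R i = {}} =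
        {i. U \<subseteq> R i \<and> V \<inter> R i = {}} - {i. insert v U \<subseteq> R i \<and> V \<inter> R i = {}}" by auto
    moreover have "finite {i. insert v U \<subseteq> R i \<and> V \<inter> R i = {}}"
      using that by (rule rev_finite_subset) blast
    moreover have "{i. insert v U \<subseteq> R i \<and> V \<inter> R i = {}} \<subseteq> {i. U \<subseteq> R i \<and> V \<inter> R i = {}}" by blast
    ultimately show ?thesis by (simp only: card_Diff_subset)
  qed
  show ?case
    using insert.IH[of U] insert.IH[of "insert v U"] insert.prems up[of "insert v U"]
    by (simp only: eq finite_insert insert_not_empty simp_thms True_implies_equals)
qed

text \<open>
  Prescribing membership on an increasing exhaustion by finite sets \<open>E n\<close> gives a decreasing
  sequence of finite index sets with intersection \<open>{i. S i = W}\<close>; such a sequence is eventually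
  constant, and the previous lemma compares its members.  The set \<open>W\<close> may be infinite: unbounded
  bars have infinitely many cells.
\<close>

lemma fibre_card_eq:
  fixes S :: "'i \<Rightarrow> 'a::countable set" and T :: "'i \<Rightarrow> 'a set"
  assumes up: "\<And>U. finite U \<Longrightarrow> U \<noteq> {} \<Longrightarrow>
      finite {i. U \<subseteq> S i} \<and> finite {j. U \<subseteq> T j} \<and> card {i. U \<subseteq> S i} = card {j. U \<subseteq> T j}"
    and "W \<noteq> {}"
  shows "finite {i. S i = W}" "finite {j. T j = W}" "card {i. S i = W} = card {j. T j = W}"
proof -
  obtain w where w: "w \<in> W" using \<open>W \<noteq> {}\<close> by blast
  define E :: "nat \<Rightarrow> 'a set" where "E n = {x. to_nat x \<le> n}" for n
  have finE: "finite (E n)" for n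
    unfolding E_def using finite_vimageI[OF finite_atMost inj_to_nat, of n] by (simp add: vimage_def)
  define A where "A R n = {i. insert w (W \<inter> E n) \<subseteq> R i \<and> (E n - W) \<inter> R i = {}}"
    for R :: "'i \<Rightarrow> 'a set" and n
  have dec: "decseq (A R)" for R :: "'i \<Rightarrow> 'a set"
  proof (rule decseq_SucI)
    fix n show "A R (Suc n) \<subseteq> A R n"
      unfolding A_def E_def by (auto dest: le_SucI)
  qed
  have Int: "(\<Inter>n. A R n) = {i. R i = W}" for R :: "'i \<Rightarrow> 'a set"
  proof
    show "{i. R i = W} \<subseteq> (\<Inter>n. A R n)" unfolding A_def using w by blast
    show "(\<Inter>n. A R n) \<subseteq> {i. R i = W}"
    proof
      fix i assume i: "i \<in> (\<Inter>n. A R n)"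
      have "x \<in> R i \<longleftrightarrow> x \<in> W" for x
      proof -
        have "i \<in> A R (to_nat x)" using i by blast
        then show ?thesis unfolding A_def E_def by auto
      qed
      then show "i \<in> {i. R i = W}" by blast
    qed
  qed
  have fin: "finite (A R 0)" if "finite {i. {w} \<subseteq> R i}" for R :: "'i \<Rightarrow> 'a set"
    using that unfolding A_def by (rule rev_finite_subset) blast
  have fS: "finite {i. {w} \<subseteq> S i}" and fT: "finite {j. {w} \<subseteq> T j}" using up[of "{w}"] by auto
  show "finite {i. S i = W}" using fS by (rule rev_finite_subset) (use w in blast)
  show "finite {j. T j = W}" using fT by (rule rev_finite_subset) (use w in blast)
  have "\<forall>\<^sub>F n in sequentially. A S n = {i. S i = W} \<and> A T n = {j. T j = W}"
    using decseq_finite_eventually_Inter[OF fin[OF fS] dec] decseq_finite_eventually_Inter[OF fin[OF fT] dec]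
    unfolding Int by (rule eventually_conj)
  then obtain n where n: "A S n = {i. S i = W}" "A T n = {j. T j = W}"
    unfolding eventually_sequentially by blast
  have "card (A S n) = card (A T n)"
    unfolding A_def using finE by (intro card_avoiding_eq[OF up]) auto
  then show "card {i. S i = W} = card {j. T j = W}" unfolding n .
qed

text \<open>
  Indices with the empty set are sent to every other element of \<open>{j. T j = {}}\<close>.  This leaves
  infinitely many indices free, so that the construction can be repeated.
\<close>

lemma fibrewise_injection:
  fixes S T :: "nat \<Rightarrow> 'a::countable set"
  assumes up: "\<And>U. finite U \<Longrightarrow> U \<noteq> {} \<Longrightarrow>
      finite {i. U \<subseteq> S i} \<and> finite {j. U \<subseteq> T j} \<and> card {i. U \<subseteq> S i} = card {j. U \<subseteq> T j}"
    and inf: "infinite {j. T j = {}}"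
  obtains \<sigma> where "inj \<sigma>" "\<And>i. T (\<sigma> i) = S i" "\<And>j. T j \<noteq> {} \<Longrightarrow> j \<in> range \<sigma>" "infinite (- range \<sigma>)"
proof -
  have "\<exists>f. bij_betw f {i. S i = W} {j. T j = W}" if "W \<noteq> {}" for W
    using fibre_card_eq[OF up that] by (intro finite_same_card_bij)
  then obtain f where f: "\<And>W. W \<noteq> {} \<Longrightarrow> bij_betw (f W) {i. S i = W} {j. T j = W}" by metis
  let ?B = "{j. T j = {}}"
  define \<sigma> where "\<sigma> i = (if S i = {} then enumerate ?B (2 * i) else f (S i) i)" for i
  have B: "T (enumerate ?B n) = {}" for n using enumerate_in_set[OF inf] by blast
  have injB: "inj (enumerate ?B)" using strict_mono_enumerate[OF inf] by (rule strict_mono_imp_inj_on)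
  have T\<sigma>: "T (\<sigma> i) = S i" for i
    unfolding \<sigma>_def using B f[of "S i"] by (auto dest: bij_betwE)
  show ?thesis
  proof
    show "inj \<sigma>"
    proof (rule injI)
      fix i i' assume eq: "\<sigma> i = \<sigma> i'"
      then have S: "S i = S i'" using T\<sigma> by metis
      show "i = i'"
      proof (cases "S i = {}")
        case True
        then show ?thesis using eq S injB unfolding \<sigma>_def by (auto dest: injD)
      next
        case False
        then show ?thesis
          using eq S bij_betw_imp_inj_on[OF f[OF False]] unfolding \<sigma>_def by (auto dest: inj_onD)
      qed
    qed
    show "T (\<sigma> i) = S i" for i by (rule T\<sigma>)
    show "j \<in> range \<sigma>" if "T j \<noteq> {}" for j
    proof -
      have "j \<in> f (T j) ` {i. S i = T j}" using bij_betw_imp_surj_on[OF f[OF that]] by blast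
      then obtain i where "S i = T j" "j = f (T j) i" by blast
      then have "j = \<sigma> i" using that unfolding \<sigma>_def by simp
      then show ?thesis by blast
    qed
    have "range (\<lambda>n. enumerate ?B (2 * n + 1)) \<subseteq> - range \<sigma>"
    proof (clarify)
      fix n i assume eq: "enumerate ?B (2 * n + 1) = \<sigma> i"
      then have "S i = {}" using B T\<sigma> by metis
      then have "2 * n + 1 = 2 * i" using eq injB unfolding \<sigma>_def by (auto dest: injD)
      then show False by presburger
    qed
    moreover have "inj (\<lambda>n. enumerate ?B (2 * n + 1))"
      by (rule injI, drule injD[OF injB]) simp
    ultimately show "infinite (- range \<sigma>)"
      using range_inj_infinite infinite_super by blast
  qed
qed

section \<open>Barcodes on a grid\<close>

text \<open>
  A union of cells \<open>[h * k, h * (k + 1))\<close> with integral \<open>k\<close>.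
\<close>

definition on_grid :: "real \<Rightarrow> real set \<Rightarrow> bool" where
  "on_grid h J \<longleftrightarrow> (\<forall>x y. \<lfloor>x / h\<rfloor> = \<lfloor>y / h\<rfloor> \<longrightarrow> x \<in> J \<longrightarrow> y \<in> J)"

lemma floor_divide_eqI: "0 < h \<Longrightarrow> h * of_int k \<le> x \<Longrightarrow> x < h * (of_int k + 1) \<Longrightarrow> \<lfloor>x / h\<rfloor> = k"
  for x :: real
  by (intro floor_unique) (simp_all add: field_simps)

lemma floor_divide_bounds:
  fixes x h :: real
  assumes "0 < h"
  shows "h * of_int \<lfloor>x / h\<rfloor> \<le> x" "x < h * (of_int \<lfloor>x / h\<rfloor> + 1)"
proof -
  show "h * of_int \<lfloor>x / h\<rfloor> \<le> x"
    using of_int_floor_le[of "x / h"] assms by (simp only: pos_le_divide_eq mult.commute)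
  show "x < h * (of_int \<lfloor>x / h\<rfloor> + 1)"
    using floor_correct[of "x / h"] assms by (simp add: field_simps)
qed

lemma on_gridD:
  assumes "on_grid h J" "0 < h" "x \<in> J" "h * of_int k \<le> x" "x < h * (of_int k + 1)"
    "h * of_int k \<le> y" "y < h * (of_int k + 1)"
  shows "y \<in> J"
  using assms floor_divide_eqI[of h k x] floor_divide_eqI[of h k y] unfolding on_grid_def by metis

text \<open>
  The union of the cells with both endpoints in \<open>J\<close>.  Requiring both makes the rounding of a tame
  barcode have only finitely many bars through each point.
\<close>

definition grid_round :: "real \<Rightarrow> real set \<Rightarrow> real set" where
  "grid_round h J = {x. h * of_int \<lfloor>x / h\<rfloor> \<in> J \<and> h * (of_int \<lfloor>x / h\<rfloor> + 1) \<in> J}"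

lemma on_grid_grid_round: "on_grid h (grid_round h J)"
  unfolding on_grid_def grid_round_def by simp

lemma is_interval_grid_round:
  assumes J: "is_interval J" and h: "0 < h"
  shows "is_interval (grid_round h J)"
  unfolding is_interval_1
proof (intro ballI allI impI)
  fix a b x assume a: "a \<in> grid_round h J" and b: "b \<in> grid_round h J" and x: "a \<le> x \<and> x \<le> b"
  have "\<lfloor>a / h\<rfloor> \<le> \<lfloor>x / h\<rfloor>" "\<lfloor>x / h\<rfloor> \<le> \<lfloor>b / h\<rfloor>"
    using x h by (auto intro!: floor_mono divide_right_mono)
  then have le: "real_of_int \<lfloor>a / h\<rfloor> \<le> real_of_int \<lfloor>x / h\<rfloor>" "real_of_int \<lfloor>x / h\<rfloor> \<le> real_of_int \<lfloor>b / h\<rfloor>"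
    by simp_all
  have "h * of_int \<lfloor>x / h\<rfloor> \<in> J"
    by (rule is_interval_between[OF J, of "h * of_int \<lfloor>a / h\<rfloor>" "h * of_int \<lfloor>b / h\<rfloor>"])
      (use a b le h in \<open>auto simp: grid_round_def\<close>)
  moreover have "h * (of_int \<lfloor>x / h\<rfloor> + 1) \<in> J"
    by (rule is_interval_between[OF J, of "h * (of_int \<lfloor>a / h\<rfloor> + 1)" "h * (of_int \<lfloor>b / h\<rfloor> + 1)"])
      (use a b le h in \<open>auto simp: grid_round_def\<close>)
  ultimately show "x \<in> grid_round h J" unfolding grid_round_def by simp
qed

lemma erosion_close_grid_round:
  assumes J: "is_interval J" and h: "0 < h"
  shows "erosion_close h J (grid_round h J)"
proof (rule erosion_closeI)
  fix x assume x: "x - h \<in> J" "x + h \<in> J"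
  have b: "h * of_int \<lfloor>x / h\<rfloor> \<le> x" "x < h * of_int \<lfloor>x / h\<rfloor> + h"
    using floor_divide_bounds[OF h, of x] by (simp_all add: algebra_simps)
  have "h * of_int \<lfloor>x / h\<rfloor> \<in> J" using b h by (intro is_interval_between[OF J x]) auto
  moreover have "h * (of_int \<lfloor>x / h\<rfloor> + 1) \<in> J"
    using b h by (intro is_interval_between[OF J x]) (auto simp: algebra_simps)
  ultimately show "x \<in> grid_round h J" unfolding grid_round_def by simp
next
  fix x assume x: "x - h \<in> grid_round h J" "x + h \<in> grid_round h J"
  have 1: "h * (of_int \<lfloor>(x - h) / h\<rfloor> + 1) \<in> J" using x(1) unfolding grid_round_def by simp
  have 2: "h * of_int \<lfloor>(x + h) / h\<rfloor> \<in> J" using x(2) unfolding grid_round_def by simp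
  have fl: "(x - h) / h = x / h - 1" "(x + h) / h = x / h + 1" using h by (simp_all add: field_simps)
  have "h * of_int \<lfloor>x / h\<rfloor> \<in> J" "h * (of_int \<lfloor>x / h\<rfloor> + 1) \<in> J"
    using 1 2 unfolding fl by simp_all
  then show "x \<in> J"
    by (rule is_interval_between[OF J]) (use floor_divide_bounds[OF h, of x] in auto)
qed

text \<open>
  The cells whose middle half lies in the interval \<open>J\<close>.  Perturbing an endpoint of the middle half
  by less than \<open>h / 4\<close> does not leave the cell.
\<close>

definition cells :: "real \<Rightarrow> real set \<Rightarrow> int set" where
  "cells h J = {k. h * (of_int k + 1/4) \<in> J \<and> h * (of_int k + 3/4) \<in> J}"

text \<open>
  An interval on the grid is determined by its cells, and the endpoints of an interval with
  at least one cell lie at a distance of less than \<open>h\<close> from those of the union of its cells.  If there are no cells, then \<open>J\<close> is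
  empty and \<open>K\<close> is too short to survive erosion.
\<close>

lemma erosion_close_if_same_cells:
  assumes J: "is_interval J" and K: "is_interval K" and h: "0 < h" and grid: "on_grid h J"
    and eq: "cells h J = cells h K"
  shows "erosion_close h J K"
proof -
  have cell: "k \<in> cells h J" if "y \<in> J" "\<lfloor>y / h\<rfloor> = k" for y k
    using on_gridD[OF grid h that(1), of k] floor_divide_bounds[OF h, of y] h that(2)
    unfolding cells_def by (auto intro!: mult_left_mono mult_strict_left_mono)
  show ?thesis
  proof (rule erosion_closeI)
    fix x assume x: "x - h \<in> J" "x + h \<in> J"
    \<comment> \<open>The cell of \<open>x\<close> lies between the two neighbouring cells, whose middle halves are in \<open>K\<close>.\<close>
    have fl: "\<lfloor>(x - h) / h\<rfloor> = \<lfloor>x / h\<rfloor> - 1" "\<lfloor>(x + h) / h\<rfloor> = \<lfloor>x / h\<rfloor> + 1"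
      using h by (simp_all add: diff_divide_distrib add_divide_distrib)
    have "\<lfloor>x / h\<rfloor> - 1 \<in> cells h K" "\<lfloor>x / h\<rfloor> + 1 \<in> cells h K"
      using cell[OF x(1) fl(1)] cell[OF x(2) fl(2)] eq by auto
    then have 1: "h * (of_int (\<lfloor>x / h\<rfloor> - 1) + 1/4) \<in> K" and 2: "h * (of_int (\<lfloor>x / h\<rfloor> + 1) + 3/4) \<in> K"
      unfolding cells_def by auto
    show "x \<in> K"
      by (rule is_interval_between[OF K 1 2])
        (use floor_divide_bounds[OF h, of x] h in \<open>auto simp: algebra_simps\<close>)
  next
    fix x assume x: "x - h \<in> K" "x + h \<in> K"
    \<comment> \<open>The cell of \<open>x\<close> lies between \<open>x - h\<close> and \<open>x + h\<close>.\<close>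
    let ?k = "\<lfloor>x / h\<rfloor>"
    note b = floor_divide_bounds[OF h, of x]
    have "h * (of_int ?k + 1/4) \<in> K" "h * (of_int ?k + 3/4) \<in> K"
      by (rule is_interval_between[OF K x]; use b h in \<open>simp add: algebra_simps\<close>)+
    then have "?k \<in> cells h J" unfolding eq by (simp add: cells_def)
    then have "h * (of_int ?k + 1/4) \<in> J" unfolding cells_def by simp
    then show "x \<in> J"
      by (rule on_gridD[OF grid h, of _ ?k]) (use b h in \<open>auto intro!: mult_left_mono mult_strict_left_mono\<close>)
  qed
qed

text \<open>
  By convexity, containing all cells in \<open>U\<close> is a condition on two points, so the number of bars
  satisfying it is a rank.
\<close>

lemma subset_cells_iff:
  assumes J: "is_interval J" and h: "0 < h" and U: "finite U" "U \<noteq> {}"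
  shows "U \<subseteq> cells h J \<longleftrightarrow> h * (of_int (Min U) + 1/4) \<in> J \<and> h * (of_int (Max U) + 3/4) \<in> J"
proof
  assume "U \<subseteq> cells h J"
  then show "h * (of_int (Min U) + 1/4) \<in> J \<and> h * (of_int (Max U) + 3/4) \<in> J"
    using Min_in[OF U] Max_in[OF U] unfolding cells_def by auto
next
  assume J2: "h * (of_int (Min U) + 1/4) \<in> J \<and> h * (of_int (Max U) + 3/4) \<in> J"
  show "U \<subseteq> cells h J"
  proof
    fix k assume "k \<in> U"
    then have "real_of_int (Min U) \<le> of_int k" "real_of_int k \<le> of_int (Max U)"
      using U by simp_all
    then have "h * (of_int (Min U) + 1/4) \<le> h * (of_int k + 1/4)"
      "h * (of_int k + 3/4) \<le> h * (of_int (Max U) + 3/4)"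
      "h * (of_int k + 1/4) \<le> h * (of_int k + 3/4)"
      using h by simp_all
    then show "k \<in> cells h J"
      unfolding cells_def using J2 is_interval_between[OF J] by (smt (verit) mem_Collect_eq)
  qed
qed

section \<open>Barcodes of tame modules\<close>

text \<open>
  The flag \<open>b\<close> selects bounded bars; it allows both spaces to be treated at once.  The finiteness
  condition is q-tameness.
\<close>

definition tame_barcode :: "bool \<Rightarrow> (nat \<Rightarrow> real set) \<Rightarrow> bool" where
  "tame_barcode b J \<longleftrightarrow> (\<forall>i. is_interval (J i) \<and> (b \<longrightarrow> bounded (J i))) \<and>
    (\<forall>x y. x < y \<longrightarrow> finite {i. x \<in> J i \<and> y \<in> J i})"

lemma tame_barcode_grid_round:
  assumes J: "tame_barcode b J" and h: "0 < h"
  shows "tame_barcode b (\<lambda>i. grid_round h (J i))"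
  unfolding tame_barcode_def
proof (intro conjI allI impI)
  fix i
  have i: "is_interval (J i)" using J unfolding tame_barcode_def by blast
  show int: "is_interval (grid_round h (J i))" using i h by (rule is_interval_grid_round)
  show "bounded (grid_round h (J i))" if b
    using bounded_erosion_close[OF int erosion_close_grid_round[OF i h]] h J that
    unfolding tame_barcode_def by auto
next
  fix x y :: real assume "x < y"
  have "h * of_int \<lfloor>x / h\<rfloor> < h * (of_int \<lfloor>x / h\<rfloor> + 1)" using h by simp
  then have "finite {i. h * of_int \<lfloor>x / h\<rfloor> \<in> J i \<and> h * (of_int \<lfloor>x / h\<rfloor> + 1) \<in> J i}"
    using J unfolding tame_barcode_def by blast
  then show "finite {i. x \<in> grid_round h (J i) \<and> y \<in> grid_round h (J i)}"
    by (rule rev_finite_subset) (auto simp: grid_round_def)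
qed

lemma tame_barcode_reindex:
  assumes K: "tame_barcode b K" and K': "\<And>j. K' (\<sigma> j) = K j" "\<And>i. i \<notin> range \<sigma> \<Longrightarrow> K' i = {}"
  shows "tame_barcode b K'"
  unfolding tame_barcode_def
proof (intro conjI allI impI)
  fix i
  show "is_interval (K' i)"
    by (cases "i \<in> range \<sigma>") (use K K' in \<open>auto simp: tame_barcode_def\<close>)
  show "bounded (K' i)" if b
    by (cases "i \<in> range \<sigma>") (use K K' that in \<open>auto simp: tame_barcode_def\<close>)
next
  fix x y :: real assume "x < y"
  then have "finite (\<sigma> ` {j. x \<in> K j \<and> y \<in> K j})" using K unfolding tame_barcode_def by blast
  moreover have "{i. x \<in> K' i \<and> y \<in> K' i} \<subseteq> \<sigma> ` {j. x \<in> K j \<and> y \<in> K j}"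
  proof
    fix i assume i: "i \<in> {i. x \<in> K' i \<and> y \<in> K' i}"
    then have "i \<in> range \<sigma>" using K'(2) by blast
    then obtain j where "i = \<sigma> j" by blast
    with i K'(1) show "i \<in> \<sigma> ` {j. x \<in> K j \<and> y \<in> K j}" by auto
  qed
  ultimately show "finite {i. x \<in> K' i \<and> y \<in> K' i}" by (rule finite_subset[rotated])
qed

text \<open>
  With \<open>p\<close> and \<open>q\<close> the outer endpoints of the middle halves of the extreme cells of \<open>U\<close>, the rank of
  \<open>bars K\<close> from \<open>p\<close> to \<open>q\<close> is at most that of \<open>bars J\<close> from \<open>p + d\<close> to \<open>q - d\<close> and at least that of
  \<open>bars J\<close> from \<open>p - d\<close> to \<open>q + d\<close>.  As \<open>d < h / 4\<close>, the grid cannot tell these points from \<open>p\<close> and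
  \<open>q\<close>.
\<close>

lemma cells_card_eq:
  assumes J: "tame_barcode b J" and K: "tame_barcode b K" and grid: "\<And>i. on_grid h (J i)"
    and d: "0 \<le> d" "d < h / 4"
    and int: "interleaved d (bars K :: 'k::field upmod) (bars J)"
    and U: "finite U" "U \<noteq> {}"
  shows "finite {i. U \<subseteq> cells h (K i)} \<and> finite {i. U \<subseteq> cells h (J i)} \<and>
    card {i. U \<subseteq> cells h (K i)} = card {i. U \<subseteq> cells h (J i)}"
proof -
  have h: "0 < h" using d by linarith
  have iJ: "is_interval (J i)" and iK: "is_interval (K i)" for i
    using J K unfolding tame_barcode_def by blast+
  define p q where "p = h * (real_of_int (Min U) + 1/4)" and "q = h * (real_of_int (Max U) + 3/4)"
  have "real_of_int (Min U) \<le> of_int (Max U)" using U by simp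
  then have "h * real_of_int (Min U) \<le> h * of_int (Max U)" using h by simp
  then have pq: "p + 2 * d \<le> q" and "p < q"
    unfolding p_def q_def distrib_left using d h by linarith+
  have fin: "finite {i. p \<in> J i \<and> q \<in> J i}" "finite {i. p \<in> K i \<and> q \<in> K i}"
    using J K \<open>p < q\<close> unfolding tame_barcode_def by blast+
  have grid_eq: "x \<in> J i \<longleftrightarrow> y \<in> J i" if "h * of_int k \<le> x" "x < h * (of_int k + 1)"
     "h * of_int k \<le> y" "y < h * (of_int k + 1)" for x y k i
    using on_gridD[OF grid h] that by blast
  have shift: "x \<in> J i \<longleftrightarrow> p \<in> J i" if "\<bar>x - p\<bar> \<le> d" for x i
    by (rule grid_eq[of "Min U"]) (use that d h in \<open>auto simp: p_def algebra_simps\<close>)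
  have shift': "x \<in> J i \<longleftrightarrow> q \<in> J i" if "\<bar>x - q\<bar> \<le> d" for x i
    by (rule grid_eq[of "Max U"]) (use that d h in \<open>auto simp: q_def algebra_simps\<close>)
  have "card {i. p \<in> K i \<and> q \<in> K i} \<le> card {i. p \<in> J i \<and> q \<in> J i}"
    using rank_le_of_interleaved[OF iK iJ d(1) pq int] fin d(1) shift[of "p + d"] shift'[of "q - d"] by simp
  moreover have "card {i. p \<in> J i \<and> q \<in> J i} \<le> card {i. p \<in> K i \<and> q \<in> K i}"
    using rank_le_of_interleaved[OF iJ iK d(1) _ interleaved_sym[OF int], of "p - d" "q + d"]
      pq fin d(1) shift[of "p - d"] shift'[of "q + d"] by simp
  ultimately show ?thesis
    using fin unfolding subset_cells_iff[OF iJ h U] subset_cells_iff[OF iK h U] p_def[symmetric] q_def[symmetric]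
    by simp
qed

text \<open>
  The substitute for algebraic stability: the barcode of a module near a grid barcode can be
  reindexed so as to be close to it bar by bar.
\<close>

lemma match_to_grid:
  assumes J: "tame_barcode b J" and K: "tame_barcode b K" and grid: "\<And>i. on_grid h (J i)"
    and d: "0 \<le> d" "d < h / 4"
    and int: "interleaved d (bars K :: 'k::field upmod) (bars J)"
    and inf: "infinite {i. J i = {}}"
  obtains K' where "tame_barcode b K'" "infinite {i. K' i = {}}"
    "interleaved 0 (bars K :: 'k upmod) (bars K')" "\<And>i. erosion_close h (J i) (K' i)"
proof -
  have h: "0 < h" using d by linarith
  have "infinite {i. cells h (J i) = {}}"
    using inf by (rule infinite_super[rotated]) (auto simp: cells_def)
  then obtain \<sigma> where \<sigma>: "inj \<sigma>" "\<And>j. cells h (J (\<sigma> j)) = cells h (K j)"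
    "\<And>i. cells h (J i) \<noteq> {} \<Longrightarrow> i \<in> range \<sigma>" "infinite (- range \<sigma>)"
    using fibrewise_injection[of "\<lambda>i. cells h (K i)" "\<lambda>i. cells h (J i)"]
      cells_card_eq[OF J K grid d int] by metis
  define K' where "K' i = (if i \<in> range \<sigma> then K (inv \<sigma> i) else {})" for i
  have K': "\<And>j. K' (\<sigma> j) = K j" "\<And>i. i \<notin> range \<sigma> \<Longrightarrow> K' i = {}"
    unfolding K'_def using \<sigma>(1) by auto
  have tame: "tame_barcode b K'" using K K' by (rule tame_barcode_reindex)
  show ?thesis
  proof
    show "tame_barcode b K'" by fact
    show "infinite {i. K' i = {}}"
      using \<sigma>(4) by (rule infinite_super[rotated]) (use K'(2) in blast)
    show "interleaved 0 (bars K :: 'k upmod) (bars K')"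
      using \<sigma>(1) K' by (rule interleaved_bars_reindex)
    fix i
    have "cells h (J i) = cells h (K' i)"
    proof (cases "i \<in> range \<sigma>")
      case True then show ?thesis using \<sigma>(2) K'(1) by auto
    next
      case False
      then have "cells h (J i) = {}" using \<sigma>(3) by blast
      then show ?thesis using K'(2)[OF False] by (simp add: cells_def)
    qed
    then show "erosion_close h (J i) (K' i)"
      using J tame h grid by (intro erosion_close_if_same_cells) (auto simp: tame_barcode_def)
  qed
qed

section \<open>Spaces of barcode modules\<close>

definition bar_space :: "bool \<Rightarrow> 'k::field upmod set set" where
  "bar_space b = iso_classes (\<lambda>M. (if b then cfid M else cid M) \<and> qtame M)"

abbreviation bar_class :: "(nat \<Rightarrow> real set) \<Rightarrow> 'k::field upmod set" where
  "bar_class J \<equiv> iso_class (bars J)"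

lemma tame_barcode_interval: "tame_barcode b J \<Longrightarrow> is_interval (J i)"
  unfolding tame_barcode_def by blast

lemma persistence_module_tame_bars:
  "tame_barcode b J \<Longrightarrow> persistence_module (bars J :: 'k::field upmod)"
  by (intro persistence_module_bars tame_barcode_interval)

lemma bar_class_in_bar_space:
  assumes J: "tame_barcode b J"
  shows "(bar_class J :: 'k::field upmod set) \<in> bar_space b"
proof -
  let ?M = "bars J :: 'k upmod" and ?I = "{i. J i \<noteq> {}}"
  note M = persistence_module_tame_bars[OF J, where 'k = 'k]
  have eq: "direct_sum ?I (\<lambda>i. interval_module (J i)) = ?M"
    unfolding direct_sum_interval_eq_bars by (intro arg_cong[where f = bars]) (auto simp: fun_eq_iff)
  have iso: "pm_isomorphic ?M (direct_sum ?I (\<lambda>i. interval_module (J i)))"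
    unfolding eq using M interleaved_refl pm_isomorphic_iff_interleaved by blast
  have "if b then cfid ?M else cid ?M"
    unfolding cfid_def cid_def using iso J unfolding tame_barcode_def
    by (auto intro!: exI[of _ ?I] exI[of _ J])
  moreover have "qtame ?M"
    using J unfolding tame_barcode_def by (subst qtame_bars_iff) auto
  ultimately show ?thesis
    unfolding bar_space_def iso_classes_def using M by (intro quotientI) blast
qed

lemma bar_class_eq:
  assumes J: "tame_barcode b J" and M: "persistence_module (M :: 'k::field upmod)"
    and "interleaved 0 M (bars J)"
  shows "iso_class M = bar_class J"
  using M persistence_module_tame_bars[OF J, where 'k = 'k] assms(3)
  by (intro equiv_class_eq[OF equiv_pm_iso_rel])
    (simp add: pm_iso_rel_def pm_isomorphic_iff_interleaved)

text \<open>
  Spreading the bars over the even numbers provides the free indices.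
\<close>

lemma bar_space_cases:
  assumes "X \<in> (bar_space b :: 'k::field upmod set set)"
  obtains K where "tame_barcode b K" "X = bar_class K" "infinite {i. K i = {}}"
proof -
  obtain M where M: "persistence_module M" "qtame M" "X = iso_class M"
    and dec: "if b then cfid M else cid M"
    using assms unfolding bar_space_def by (blast elim: iso_classes_cases)
  obtain I :: "nat set" and J where J: "\<And>i. i \<in> I \<Longrightarrow> is_interval (J i) \<and> (b \<longrightarrow> bounded (J i))"
    and iso: "pm_isomorphic M (direct_sum I (\<lambda>i. interval_module (J i)))"
  proof (cases b)
    case True
    with dec that show ?thesis unfolding cfid_def by auto
  next
    case False
    with dec that show ?thesis unfolding cid_def by auto
  qed
  define K where "K i = (if i \<in> I then J i else {})" for i
  have K: "is_interval (K i) \<and> (b \<longrightarrow> bounded (K i))" for i unfolding K_def using J by auto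
  have P: "persistence_module (bars K :: 'k upmod)" using K by (intro persistence_module_bars) blast
  have int: "interleaved 0 M (bars K)"
    using iso P M(1) unfolding direct_sum_interval_eq_bars K_def[symmetric]
    by (simp add: pm_isomorphic_iff_interleaved)
  have "qtame (bars K :: 'k upmod)" using qtame_isomorphic[OF M(1) P int M(2)] .
  then have tame: "tame_barcode b K"
    unfolding tame_barcode_def using K qtame_bars_iff[of K] by blast
  define K' where "K' i = (if even i then K (i div 2) else {})" for i
  have K': "\<And>j. K' (2 * j) = K j" "\<And>i. i \<notin> range ((*) 2) \<Longrightarrow> K' i = {}"
    unfolding K'_def by (auto elim!: evenE)
  have tame': "tame_barcode b K'" using tame K' by (rule tame_barcode_reindex)
  have "interleaved 0 (bars K :: 'k upmod) (bars K')"
    by (rule interleaved_bars_reindex[of "(*) 2"]) (use K' in \<open>auto simp: inj_def\<close>)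
  then have "interleaved 0 M (bars K')"
    using interleaved_trans[OF M(1) persistence_module_tame_bars[OF tame'] _ _ int] by simp
  then have "X = bar_class K'" unfolding M(3) using tame' M(1) by (intro bar_class_eq)
  moreover have "infinite {i. K' i = {}}"
  proof (rule infinite_super)
    show "range (\<lambda>n. 2 * n + 1) \<subseteq> {i. K' i = {}}" unfolding K'_def by auto
    show "infinite (range (\<lambda>n::nat. 2 * n + 1))" by (intro range_inj_infinite) (auto simp: inj_def)
  qed
  ultimately show ?thesis using that tame' by blast
qed

lemma bar_class_in_ball:
  assumes J: "tame_barcode b J" and K: "tame_barcode b K"
    and e: "0 \<le> e" "e < r" and c: "\<And>i. erosion_close e (J i) (K i)"
  shows "(bar_class K :: 'k::field upmod set) \<in> class_ball (bar_space b) (bar_class J) r"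
proof -
  have "interleaved e (bars J :: 'k upmod) (bars K)"
    using J K e(1) c by (intro interleaved_bars tame_barcode_interval)
  then show ?thesis
    unfolding class_ball_def
    using e bar_class_in_bar_space[OF K]
      class_dist_less_iff[OF persistence_module_tame_bars[OF J] persistence_module_tame_bars[OF K]]
    by auto
qed

text \<open>
  The points of the nested sequence.  The free indices receive the additional short bars of the
  next point.
\<close>

definition grid_barcode :: "bool \<Rightarrow> real \<Rightarrow> (nat \<Rightarrow> real set) \<Rightarrow> bool" where
  "grid_barcode b h J \<longleftrightarrow>
    0 < h \<and> tame_barcode b J \<and> (\<forall>i. on_grid h (J i)) \<and> infinite {i. J i = {}}"

text \<open>
  Rounding to a sufficiently fine grid stays in an open set.  The factor \<open>4\<close> bounds the total
  movement of a bar in all later steps, see \<open>erosion_close_limit_bar\<close>.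
\<close>

lemma grid_barcode_inside_open:
  fixes V :: "'k::field upmod set set"
  assumes K: "tame_barcode b K" "infinite {i. K i = {}}"
    and V: "openin (interleaving_topology (bar_space b)) V" "bar_class K \<in> V" and h0: "0 < h\<^sub>0"
  obtains h J where "grid_barcode b h J" "h \<le> h\<^sub>0" "\<And>i. erosion_close h (K i) (J i)"
    "\<And>L. tame_barcode b L \<Longrightarrow> (\<And>i. erosion_close (4 * h) (J i) (L i)) \<Longrightarrow> bar_class L \<in> V"
proof -
  obtain r where r: "0 < r" "class_ball (bar_space b) (bar_class K) r \<subseteq> V"
    using V unfolding openin_interleaving_topology by blast
  define h where "h = min h\<^sub>0 (r / 6)"
  have h: "0 < h" "h \<le> h\<^sub>0" "5 * h < r" unfolding h_def using h0 r(1) by (auto simp: min_def)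
  define J where "J i = grid_round h (K i)" for i
  have tJ: "tame_barcode b J" unfolding J_def using K(1) h(1) by (rule tame_barcode_grid_round)
  have close: "erosion_close h (K i) (J i)" for i
    unfolding J_def by (intro erosion_close_grid_round tame_barcode_interval[OF K(1)] h(1))
  show ?thesis
  proof
    have "{i. K i = {}} \<subseteq> {i. J i = {}}" unfolding J_def grid_round_def by auto
    then show "grid_barcode b h J"
      unfolding grid_barcode_def
      using h(1) tJ K(2) infinite_super by (auto simp: J_def on_grid_grid_round)
    show "h \<le> h\<^sub>0" by fact
    show "erosion_close h (K i) (J i)" for i by (rule close)
    fix L assume L: "tame_barcode b L" "\<And>i. erosion_close (4 * h) (J i) (L i)"
    have "erosion_close (h + 4 * h) (K i) (L i)" for i
      using h(1) by (intro erosion_close_trans[OF tame_barcode_interval[OF K(1)]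
            tame_barcode_interval[OF L(1)] _ _ close L(2)]) auto
    then have "bar_class L \<in> class_ball (bar_space b) (bar_class K) r"
      using h by (intro bar_class_in_ball[OF K(1) L(1), of "h + 4 * h"]) auto
    then show "bar_class L \<in> V" using r(2) by blast
  qed
qed

text \<open>
  The step of the Baire argument.  A nowhere dense closed set misses a point in the ball of radius
  \<open>h / 4\<close>; its barcode is matched with \<open>J\<close> and then rounded to a finer grid.  Matching and rounding
  move the bars by \<open>h\<close> and \<open>h' \<le> h / 2\<close>.
\<close>

lemma grid_barcode_avoiding:
  fixes C :: "'k::field upmod set set"
  assumes J: "grid_barcode b h J"
    and C: "closedin (interleaving_topology (bar_space b)) C"
      "interleaving_topology (bar_space b) interior_of C = {}"
  obtains h' J' where "grid_barcode b h' J'" "h' \<le> h / 2"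
    "\<And>i. erosion_close (2 * h) (J i) (J' i)"
    "\<And>L. tame_barcode b L \<Longrightarrow> (\<And>i. erosion_close (4 * h') (J' i) (L i)) \<Longrightarrow> bar_class L \<notin> C"
proof -
  let ?X = "interleaving_topology (bar_space b :: 'k upmod set set)"
  let ?B = "class_ball (bar_space b) (bar_class J :: 'k upmod set) (h / 4)"
  have h: "0 < h" and tJ: "tame_barcode b J" and grid: "\<And>i. on_grid h (J i)"
    and inf: "infinite {i. J i = {}}"
    using J unfolding grid_barcode_def by auto
  note PJ = persistence_module_tame_bars[OF tJ, where 'k = 'k]
  have "bar_class J \<in> ?B"
    using h tJ by (intro bar_class_in_ball[of b J J 0] erosion_close_refl tame_barcode_interval) auto
  moreover have "openin ?X ?B"
    using openin_class_ball[OF bar_space_def] bar_class_in_bar_space[OF tJ] by blast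
  ultimately have "\<not> ?B \<subseteq> C" using C(2) interior_of_maximal by blast
  then obtain Y where Y: "Y \<in> ?B" "Y \<notin> C" by blast
  have Yb: "Y \<in> bar_space b" using Y(1) unfolding class_ball_def by blast
  then obtain K where K: "tame_barcode b K" "Y = bar_class K" by (rule bar_space_cases)
  note PK = persistence_module_tame_bars[OF K(1), where 'k = 'k]
  obtain d where d: "0 \<le> d" "d < h / 4" "interleaved d (bars J :: 'k upmod) (bars K)"
    using Y(1) class_dist_less_iff[OF PJ PK] unfolding class_ball_def K(2) by auto
  obtain K' where K': "tame_barcode b K'" "infinite {i. K' i = {}}"
    "interleaved 0 (bars K :: 'k upmod) (bars K')" "\<And>i. erosion_close h (J i) (K' i)"
    by (rule match_to_grid[OF tJ K(1) grid d(1,2) interleaved_sym[OF d(3)] inf]) blast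
  have YK': "Y = bar_class K'" unfolding K(2) using K'(1) PK K'(3) by (rule bar_class_eq)
  have top: "topspace ?X = bar_space b"
  proof
    show "topspace ?X \<subseteq> bar_space b"
      using openin_topspace[of ?X] unfolding openin_interleaving_topology by blast
    have "openin ?X (bar_space b)"
      unfolding openin_interleaving_topology by (auto simp: class_ball_def intro: exI[of _ 1])
    then show "bar_space b \<subseteq> topspace ?X" by (rule openin_subset)
  qed
  have "openin ?X (bar_space b - C)" using C(1) unfolding closedin_def top by blast
  moreover have "bar_class K' \<in> bar_space b - C" using Yb Y(2) unfolding YK' by blast
  ultimately obtain h' J' where J': "grid_barcode b h' J'" "h' \<le> h / 2"
    "\<And>i. erosion_close h' (K' i) (J' i)"
    "\<And>L. tame_barcode b L \<Longrightarrow> (\<And>i. erosion_close (4 * h') (J' i) (L i)) \<Longrightarrow>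
       bar_class L \<in> bar_space b - C"
    using grid_barcode_inside_open[OF K'(1,2), of "bar_space b - C" "h / 2"] h half_gt_zero by metis
  have h': "0 < h'" and tJ': "tame_barcode b J'" using J'(1) unfolding grid_barcode_def by auto
  show ?thesis
  proof
    show "grid_barcode b h' J'" "h' \<le> h / 2" by fact+
    fix i
    note iJ = tame_barcode_interval[OF tJ, of i] and iJ' = tame_barcode_interval[OF tJ', of i]
    have "erosion_close (h + h') (J i) (J' i)"
      using h h' by (intro erosion_close_trans[OF iJ iJ' _ _ K'(4) J'(3)]) auto
    then show "erosion_close (2 * h) (J i) (J' i)"
      using h h' J'(2) by - (rule erosion_close_mono[OF iJ iJ', of "h + h'"]; auto)
  next
    fix L assume "tame_barcode b L" "\<And>i. erosion_close (4 * h') (J' i) (L i)"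
    then show "bar_class L \<notin> C" using J'(4) by blast
  qed
qed

section \<open>Limits of barcodes\<close>

text \<open>
  The lower limit of the sets \<open>J n i\<close>.  In this form closeness passes to the limit point by
  point.
\<close>

definition limit_bar :: "(nat \<Rightarrow> nat \<Rightarrow> real set) \<Rightarrow> nat \<Rightarrow> real set" where
  "limit_bar J i = {x. \<forall>\<^sub>F n in sequentially. x \<in> J n i}"

text \<open>
  Halving gives \<open>2 * h n \<le> 4 * h n - 4 * h (Suc n)\<close>, so the distances telescope: from step \<open>n\<close> to
  step \<open>n + m\<close> a bar moves by at most \<open>4 * h n - 4 * h (n + m)\<close>.
\<close>

lemma erosion_close_limit_bar:
  assumes J: "\<And>n i. is_interval (J n i)" and pos: "\<And>n. 0 < h n" and half: "\<And>n. h (Suc n) \<le> h n / 2"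
    and c: "\<And>n i. erosion_close (2 * h n) (J n i) (J (Suc n) i)"
  shows "erosion_close (4 * h n) (J n i) (limit_bar J i)"
proof -
  have dec: "h (n + m) \<le> h n" for m
  proof (induction m)
    case (Suc m)
    then show ?case using half[of "n + m"] pos[of "n + m"] by simp
  qed simp
  have tail: "erosion_close (4 * h n - 4 * h (n + m)) (J n i) (J (n + m) i)" for m
  proof (induction m)
    case 0
    then show ?case using erosion_close_refl[OF J] by simp
  next
    case (Suc m)
    have "erosion_close (4 * h n - 4 * h (n + m) + 2 * h (n + m)) (J n i) (J (Suc (n + m)) i)"
      using pos[of "n + m"] dec[of m] by (intro erosion_close_trans[OF J J _ _ Suc c]) auto
    then show ?case
      using half[of "n + m"] pos[of "n + m"] dec[of m]
      by - (rule erosion_close_mono[OF J J, of "4 * h n - 4 * h (n + m) + 2 * h (n + m)"]; auto)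
  qed
  have close: "erosion_close (4 * h n) (J n i) (J (n + m) i)" for m
    using pos[of "n + m"] dec[of m] by (intro erosion_close_mono[OF J J _ _ tail]) auto
  show ?thesis
  proof (rule erosion_closeI)
    fix x assume "x - 4 * h n \<in> J n i" "x + 4 * h n \<in> J n i"
    then have "x \<in> J (n + m) i" for m by (rule erosion_closeD[OF close])
    then show "x \<in> limit_bar J i"
      unfolding limit_bar_def eventually_sequentially by (auto intro!: exI[of _ n] simp: le_iff_add)
  next
    fix x assume "x - 4 * h n \<in> limit_bar J i" "x + 4 * h n \<in> limit_bar J i"
    then have "\<forall>\<^sub>F m in sequentially. x - 4 * h n \<in> J m i \<and> x + 4 * h n \<in> J m i"
      unfolding limit_bar_def by (simp add: eventually_conj_iff)
    then obtain N where N: "\<And>m. N \<le> m \<Longrightarrow> x - 4 * h n \<in> J m i \<and> x + 4 * h n \<in> J m i"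
      unfolding eventually_sequentially by blast
    show "x \<in> J n i"
      using N[of "n + N"] by (intro erosion_closeD[OF erosion_close_sym[OF close[of N]]]) auto
  qed
qed

lemma is_interval_limit_bar:
  assumes J: "\<And>n i. is_interval (J n i)"
  shows "is_interval (limit_bar J i)"
  unfolding is_interval_1
proof (intro ballI allI impI)
  fix a b x assume "a \<in> limit_bar J i" "b \<in> limit_bar J i" and x: "a \<le> x \<and> x \<le> b"
  then have "\<forall>\<^sub>F n in sequentially. a \<in> J n i \<and> b \<in> J n i"
    unfolding limit_bar_def by (simp add: eventually_conj_iff)
  then have "\<forall>\<^sub>F n in sequentially. x \<in> J n i"
    by (rule eventually_mono) (use x is_interval_between[OF J] in blast)
  then show "x \<in> limit_bar J i" unfolding limit_bar_def by simp
qed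

text \<open>
  Bars of the limit through \<open>x\<close> and \<open>y\<close> are visible in every approximation with error
  \<open>e n < (y - x) / 2\<close>: there they pass through \<open>x + e n\<close> and \<open>y - e n\<close>, and tameness of this
  approximation leaves only finitely many of them.
\<close>

lemma tame_barcode_limit:
  assumes J: "\<And>n. tame_barcode b (J n)" and L: "\<And>i. is_interval (L i)"
    and e: "\<And>n. 0 \<le> e n" "e \<longlonglongrightarrow> 0" and c: "\<And>n i. erosion_close (e n) (J n i) (L i)"
  shows "tame_barcode b L"
  unfolding tame_barcode_def
proof (intro conjI allI impI)
  show "is_interval (L i)" for i by (rule L)
  show "bounded (L i)" if b for i
    using bounded_erosion_close[OF L c e(1), of 0 i] J[of 0] that unfolding tame_barcode_def by blast
next
  fix x y :: real assume "x < y"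
  then have "\<forall>\<^sub>F n in sequentially. e n < (y - x) / 2" by (intro order_tendstoD[OF e(2)]) simp
  then obtain n where n: "e n < (y - x) / 2" unfolding eventually_sequentially by blast
  have "finite {i. x + e n \<in> J n i \<and> y - e n \<in> J n i}"
    using J[of n] n unfolding tame_barcode_def by (simp add: field_simps)
  moreover have "{i. x \<in> L i \<and> y \<in> L i} \<subseteq> {i. x + e n \<in> J n i \<and> y - e n \<in> J n i}"
  proof clarify
    fix i assume xy: "x \<in> L i" "y \<in> L i"
    have "z \<in> J n i" if "x + e n \<le> z" "z \<le> y - e n" for z
      by (rule erosion_closeD[OF erosion_close_sym[OF c]]; rule is_interval_between[OF L xy])
        (use that e(1)[of n] in auto)
    then show "x + e n \<in> J n i \<and> y - e n \<in> J n i" using n by auto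
  qed
  ultimately show "finite {i. x \<in> L i \<and> y \<in> L i}" by (rule finite_subset[rotated])
qed

section \<open>The Baire property\<close>

lemma bar_space_not_covered:
  fixes C :: "nat \<Rightarrow> 'k::field upmod set set"
  assumes C: "\<And>n. closedin (interleaving_topology (bar_space b)) (C n)"
      "\<And>n. interleaving_topology (bar_space b) interior_of C n = {}"
    and U: "openin (interleaving_topology (bar_space b)) U" "U \<noteq> {}"
  shows "\<not> U \<subseteq> (\<Union>n. C n)"
proof -
  obtain X where X: "X \<in> U" using U(2) by blast
  then have "X \<in> bar_space b" using U(1) unfolding openin_interleaving_topology by blast
  then obtain K where K: "tame_barcode b K" "X = bar_class K" "infinite {i. K i = {}}"
    by (rule bar_space_cases)
  \<comment> \<open>The bound \<open>1\<close> is arbitrary.\<close>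
  obtain h0 J0 where J0: "grid_barcode b h0 J0"
    "\<And>L. tame_barcode b L \<Longrightarrow> (\<And>i. erosion_close (4 * h0) (J0 i) (L i)) \<Longrightarrow> bar_class L \<in> U"
    by (rule grid_barcode_inside_open[OF K(1,3) U(1) X[unfolded K(2)] zero_less_one]) blast
  define good where "good = (\<lambda>n (h, J) (h', J'). h' \<le> h / 2 \<and>
    (\<forall>i. erosion_close (2 * h) (J i) (J' i)) \<and>
    (\<forall>L. tame_barcode b L \<longrightarrow> (\<forall>i. erosion_close (4 * h') (J' i) (L i)) \<longrightarrow> bar_class L \<notin> C n))"
  have "\<exists>f. \<forall>n. (grid_barcode b (fst (f n)) (snd (f n)) \<and> (n = 0 \<longrightarrow> f n = (h0, J0))) \<and>
      good n (f n) (f (Suc n))"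
  proof (rule dependent_nat_choice)
    show "\<exists>s. grid_barcode b (fst s) (snd s) \<and> (0 = 0 \<longrightarrow> s = (h0, J0))" using J0(1) by auto
    fix s :: "real \<times> (nat \<Rightarrow> real set)" and n :: nat
    assume "grid_barcode b (fst s) (snd s) \<and> (n = 0 \<longrightarrow> s = (h0, J0))"
    then have "grid_barcode b (fst s) (snd s)" ..
    from grid_barcode_avoiding[OF this C(1)[of n] C(2)[of n]] obtain h' J' where
      "grid_barcode b h' J'" "h' \<le> fst s / 2" "\<And>i. erosion_close (2 * fst s) (snd s i) (J' i)"
      "\<And>L. tame_barcode b L \<Longrightarrow> (\<And>i. erosion_close (4 * h') (J' i) (L i)) \<Longrightarrow> bar_class L \<notin> C n"
      by metis
    then have "grid_barcode b (fst (h', J')) (snd (h', J')) \<and> good n s (h', J')"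
      unfolding good_def by (auto simp: case_prod_beta)
    then show "\<exists>s'. (grid_barcode b (fst s') (snd s') \<and> (Suc n = 0 \<longrightarrow> s' = (h0, J0))) \<and> good n s s'"
      by blast
  qed
  then obtain f :: "nat \<Rightarrow> real \<times> (nat \<Rightarrow> real set)"
    where f: "\<And>n. grid_barcode b (fst (f n)) (snd (f n))" "f 0 = (h0, J0)"
    "\<And>n. good n (f n) (f (Suc n))" by blast
  define h where "h n = fst (f n)" for n :: nat
  define J where "J n = snd (f n)" for n :: nat
  have grid: "grid_barcode b (h n) (J n)" for n unfolding h_def J_def by (rule f)
  have half: "h (Suc n) \<le> h n / 2" and step: "erosion_close (2 * h n) (J n i) (J (Suc n) i)"
    and avoid: "tame_barcode b L \<Longrightarrow> (\<And>i. erosion_close (4 * h (Suc n)) (J (Suc n) i) (L i)) \<Longrightarrow>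
      bar_class L \<notin> C n" for n :: nat and i L
    using f(3)[of n] unfolding good_def h_def J_def by (auto simp: case_prod_beta)
  have pos: "0 < h n" and tame: "tame_barcode b (J n)" for n
    using grid[of n] unfolding grid_barcode_def by auto
  have int: "is_interval (J n i)" for n i using tame by (rule tame_barcode_interval)
  have lim: "h \<longlonglongrightarrow> 0"
  proof (rule tendsto_sandwich)
    have "h n \<le> h 0 * (1 / 2) ^ n" for n
    proof (induction n)
      case (Suc n)
      then show ?case using half[of n] by simp
    qed simp
    then show "\<forall>\<^sub>F n in sequentially. h n \<le> h 0 * (1 / 2) ^ n" by simp
    show "\<forall>\<^sub>F n in sequentially. 0 \<le> h n" using pos by (simp add: less_imp_le)
    show "(\<lambda>n. h 0 * (1 / 2) ^ n) \<longlonglongrightarrow> 0"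
      by (intro tendsto_mult_right_zero LIMSEQ_power_zero) simp
  qed simp
  let ?L = "limit_bar J"
  have close: "erosion_close (4 * h n) (J n i) (?L i)" for n i
    by (rule erosion_close_limit_bar[of J h, OF int pos half step])
  have L: "tame_barcode b ?L"
  proof (rule tame_barcode_limit[OF tame is_interval_limit_bar[OF int] _ _ close])
    show "0 \<le> 4 * h n" for n using pos[of n] by simp
    show "(\<lambda>n. 4 * h n) \<longlonglongrightarrow> 0" using lim by (rule tendsto_mult_right_zero)
  qed
  have "bar_class ?L \<in> U"
    using J0(2)[OF L] close[of 0] f(2) unfolding h_def J_def by simp
  moreover have "bar_class ?L \<notin> C n" for n by (rule avoid[OF L close])
  ultimately show ?thesis by blast
qed

lemma baire_space_bar_space: "baire_space (interleaving_topology (bar_space b :: 'k::field upmod set set))"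
  unfolding baire_space_def
proof (intro allI impI)
  let ?X = "interleaving_topology (bar_space b :: 'k upmod set set)"
  fix F :: "'k upmod set set set"
  assume F: "countable F" and closed: "\<forall>C\<in>F. closedin ?X C \<and> ?X interior_of C = {}"
  show "?X interior_of \<Union>F = {}"
  proof (cases "F = {}")
    case False
    have ran: "range (from_nat_into F) = F" using False F by (rule range_from_nat_into)
    have "closedin ?X (from_nat_into F n)" "?X interior_of (from_nat_into F n) = {}" for n
      using closed from_nat_into[OF False, of n] by auto
    from bar_space_not_covered[of b "from_nat_into F", OF this, of "?X interior_of \<Union>F"]
    show ?thesis using interior_of_subset[of ?X "\<Union>F"] openin_interior_of unfolding ran by blast
  qed simp
qed

theorem corollary4p36:
  shows "baire_space (interleaving_topology
           (iso_classes (\<lambda>M :: 'k::field upmod. cid M \<and> qtame M))) \<and>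
         baire_space (interleaving_topology
           (iso_classes (\<lambda>M :: 'k::field upmod. cfid M \<and> qtame M)))"
  using baire_space_bar_space[of False, where 'k = 'k] baire_space_bar_space[of True, where 'k = 'k]
  unfolding bar_space_def by simp

end
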